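(* Let $(X,x_0)$ and $(Y,y_0)$ be based metric spaces where $Y$ is purely 2-unrectifiable. Let $\varphi:(X,x_0)\hookrightarrow(Y,y_0)$ be a based biLipschitz embedding. Then the induced homomorphism $$\varphi_{\#}:\pi_1^{\mathrm{Lip}}(X,x_0)\longrightarrow\pi_1^{\mathrm{Lip}}(Y,y_0)$$ is injective.
   Context: A metric space $Y$ is purely 2-unrectifiable if for every Borel set $A\subset\mathbb{R}^2$ and every Lipschitz map $f:A\to Y$, the 2-dimensional Hausdorff measure of $f(A)$ is zero. All paths and loops are Lipschitz with domain $I=[0,1]$. $I\times I$ carries the $L^1$ metric. Two paths $\gamma,\gamma'$ in a metric space $M$ with the same initial points and the same end points are homotopic rel endpoints if there is a Lipschitz map $H:I\times I\to M$ with $H|_{I\times\{0\}}=\gamma$, $H|_{I\times\{1\}}=\gamma'$, $H|_{\{0\}\times I}\equiv\gamma(0)$, $H|_{\{1\}\times I}\equiv\gamma(1)$; $[\gamma]$ denotes the class of $\gamma$. The first Lipschitz homotopy group $\pi_1^{\mathrm{Lip}}(M,p_0)$ of a based metric space $(M,p_0)$ is the set of classes of loops based at $p_0$ with group operation given by concatenation. A based Lipschitz map $f$ induces the homomorphism $f_\#[\alpha]=[f\circ\alpha]$. A biLipschitz embedding is an injective Lipschitz map whose inverse, defined on its image, is Lipschitz. *)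

theory Defs
  imports "HOL-Analysis.Analysis" "HOL-Algebra.Group"
begin

text \<open>A metric space is a subset \<open>M\<close> of a type of class \<^class>\<open>metric_space\<close>, with the
  restricted metric.\<close>

section \<open>Pure 2-unrectifiability\<close>

text \<open>The factor \<open>pi / 4\<close> is the usual normalization, the area of a planar disc of diameter one.
  Boundedness of the covering sets is required because \<^const>\<open>diameter\<close> is a real number
  and has no meaning on unbounded sets. The size of an arbitrary set \<open>S\<close> is that given by
  the Hausdorff outer measure; covering sets need not lie in \<open>S\<close>, but intersecting them
  with \<open>S\<close> does not increase diameters, so the value depends on the metric of \<open>S\<close> only.\<close>

definition hausdorff2_pre :: "real \<Rightarrow> 'a::metric_space set \<Rightarrow> ennreal" where
  "hausdorff2_pre \<delta> S =
     (INF U \<in> {U :: nat \<Rightarrow> 'a set. S \<subseteq> (\<Union>i. U i) \<and> (\<forall>i. bounded (U i) \<and> diameter (U i) \<le> \<delta>)}.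
        \<Sum>i. ennreal (pi / 4 * diameter (U i) ^ 2))"

definition hausdorff2 :: "'a::metric_space set \<Rightarrow> ennreal" where
  "hausdorff2 S = (SUP \<delta> \<in> {0<..}. hausdorff2_pre \<delta> S)"

definition purely_2_unrectifiable :: "'a::metric_space set \<Rightarrow> bool" where
  "purely_2_unrectifiable Y \<longleftrightarrow>
     (\<forall>(A :: (real^2) set) f C. A \<in> sets borel \<and> f \<in> A \<rightarrow> Y \<and> C-lipschitz_on A f
        \<longrightarrow> hausdorff2 (f ` A) = 0)"

section \<open>Lipschitz paths and homotopies\<close>

text \<open>As for the library's \<^const>\<open>path\<close>, paths are functions on \<^typ>\<open>real\<close> of which only the
  values on \<open>{0..1}\<close> matter, so a homotopy class contains all extensions of each of its paths.\<close>

definition lip_path :: "'a::metric_space set \<Rightarrow> (real \<Rightarrow> 'a) \<Rightarrow> bool" where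
  "lip_path M \<gamma> \<longleftrightarrow> \<gamma> \<in> {0..1} \<rightarrow> M \<and> (\<exists>C. C-lipschitz_on {0..1} \<gamma>)"

definition lip_loops :: "'a::metric_space set \<Rightarrow> 'a \<Rightarrow> (real \<Rightarrow> 'a) set" where
  "lip_loops M p = {\<gamma>. lip_path M \<gamma> \<and> pathstart \<gamma> = p \<and> pathfinish \<gamma> = p}"

text \<open>The product metric of the library on \<^typ>\<open>real \<times> real\<close> is Euclidean, so the
  Lipschitz condition for the \<open>L\<^sup>1\<close> metric on the square is written out.\<close>

definition lip_square :: "real \<Rightarrow> (real \<times> real \<Rightarrow> 'a::metric_space) \<Rightarrow> bool" where
  "lip_square C H \<longleftrightarrow> 0 \<le> C \<and>
     (\<forall>s\<in>{0..1}. \<forall>t\<in>{0..1}. \<forall>s'\<in>{0..1}. \<forall>t'\<in>{0..1}.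
        dist (H (s, t)) (H (s', t')) \<le> C * (\<bar>s - s'\<bar> + \<bar>t - t'\<bar>))"

definition lip_homotopic :: "'a::metric_space set \<Rightarrow> (real \<Rightarrow> 'a) \<Rightarrow> (real \<Rightarrow> 'a) \<Rightarrow> bool" where
  "lip_homotopic M \<gamma> \<gamma>' \<longleftrightarrow>
     lip_path M \<gamma> \<and> lip_path M \<gamma>' \<and>
     pathstart \<gamma>' = pathstart \<gamma> \<and> pathfinish \<gamma>' = pathfinish \<gamma> \<and>
     (\<exists>H C. H \<in> {0..1} \<times> {0..1} \<rightarrow> M \<and> lip_square C H \<and>
        (\<forall>s\<in>{0..1}. H (s, 0) = \<gamma> s) \<and> (\<forall>s\<in>{0..1}. H (s, 1) = \<gamma>' s) \<and>
        (\<forall>t\<in>{0..1}. H (0, t) = pathstart \<gamma>) \<and> (\<forall>t\<in>{0..1}. H (1, t) = pathfinish \<gamma>))"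

definition lip_class :: "'a::metric_space set \<Rightarrow> (real \<Rightarrow> 'a) \<Rightarrow> (real \<Rightarrow> 'a) set" where
  "lip_class M \<gamma> = {\<gamma>'. lip_homotopic M \<gamma> \<gamma>'}"

section \<open>The first Lipschitz homotopy group\<close>

text \<open>Operations on classes are unions over all representatives; the lemmas
  \<open>lip_pi1_mult\<close> and \<open>lip_induced_class\<close> below show that they are computed on
  any single representative.\<close>

definition lip_pi1 :: "'a::metric_space set \<Rightarrow> 'a \<Rightarrow> (real \<Rightarrow> 'a) set monoid" where
  "lip_pi1 M p =
     \<lparr>carrier = lip_class M ` lip_loops M p,
      mult = (\<lambda>c d. \<Union>\<alpha>\<in>c. \<Union>\<beta>\<in>d. lip_class M (\<alpha> +++ \<beta>)),
      one = lip_class M (\<lambda>_. p)\<rparr>"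

definition lip_induced ::
    "'b::metric_space set \<Rightarrow> ('a::metric_space \<Rightarrow> 'b) \<Rightarrow> (real \<Rightarrow> 'a) set \<Rightarrow> (real \<Rightarrow> 'b) set" where
  "lip_induced N f c = (\<Union>\<alpha>\<in>c. lip_class N (f \<circ> \<alpha>))"

definition bilipschitz_embedding ::
    "'a::metric_space set \<Rightarrow> 'b::metric_space set \<Rightarrow> ('a \<Rightarrow> 'b) \<Rightarrow> bool" where
  "bilipschitz_embedding X Y f \<longleftrightarrow>
     f \<in> X \<rightarrow> Y \<and> inj_on f X \<and> (\<exists>C. C-lipschitz_on X f) \<and>
     (\<exists>C. C-lipschitz_on (f ` X) (inv_into X f))"

section \<open>The operations are well defined and form a group\<close>

lemma lip_squareD:
  assumes "lip_square C H" "s \<in> {0..1}" "t \<in> {0..1}" "s' \<in> {0..1}" "t' \<in> {0..1}"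
  shows "dist (H (s, t)) (H (s', t')) \<le> C * (\<bar>s - s'\<bar> + \<bar>t - t'\<bar>)"
  using assms unfolding lip_square_def by blast

lemma lip_squareD1:
  assumes "lip_square C H" "t \<in> {0..1}" shows "C-lipschitz_on {0..1} (\<lambda>s. H (s, t))"
proof (rule lipschitz_onI)
  show "dist (H (x, t)) (H (y, t)) \<le> C * dist x y" if "x \<in> {0..1}" "y \<in> {0..1}" for x y
    using lip_squareD[OF assms(1) that(1) assms(2) that(2) assms(2)] by (simp add: dist_real_def)
qed (use assms in \<open>simp add: lip_square_def\<close>)

lemma lip_squareD2:
  assumes "lip_square C H" "s \<in> {0..1}" shows "C-lipschitz_on {0..1} (\<lambda>t. H (s, t))"
proof (rule lipschitz_onI)
  show "dist (H (s, x)) (H (s, y)) \<le> C * dist x y" if "x \<in> {0..1}" "y \<in> {0..1}" for x y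
    using lip_squareD[OF assms(1) assms(2) that(1) assms(2) that(2)] by (simp add: dist_real_def)
qed (use assms in \<open>simp add: lip_square_def\<close>)

lemma lip_squareI:
  fixes H :: "real \<times> real \<Rightarrow> 'a::metric_space"
  assumes "\<And>t. t \<in> {0..1} \<Longrightarrow> C-lipschitz_on {0..1} (\<lambda>s. H (s, t))"
    and "\<And>s. s \<in> {0..1} \<Longrightarrow> D-lipschitz_on {0..1} (\<lambda>t. H (s, t))"
  shows "lip_square (max C D) H"
proof -
  have C: "0 \<le> C" using lipschitz_on_nonneg[OF assms(1)[of 0]] by simp
  have "dist (H (s, t)) (H (s', t')) \<le> max C D * (\<bar>s - s'\<bar> + \<bar>t - t'\<bar>)"
    if "s \<in> {0..1}" "t \<in> {0..1}" "s' \<in> {0..1}" "t' \<in> {0..1}" for s t s' t'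
  proof -
    have "dist (H (s, t)) (H (s', t')) \<le> dist (H (s, t)) (H (s', t)) + dist (H (s', t)) (H (s', t'))"
      by (rule dist_triangle)
    also have "\<dots> \<le> C * \<bar>s - s'\<bar> + D * \<bar>t - t'\<bar>"
      using lipschitz_onD[OF assms(1)[of t], of s s'] lipschitz_onD[OF assms(2)[of s'], of t t'] that
      by (simp add: dist_real_def)
    also have "\<dots> \<le> max C D * \<bar>s - s'\<bar> + max C D * \<bar>t - t'\<bar>"
      by (intro add_mono mult_right_mono) auto
    finally show ?thesis by (simp add: distrib_left)
  qed
  then show ?thesis using C unfolding lip_square_def by auto
qed

lemma lip_homotopicI:
  fixes H :: "real \<times> real \<Rightarrow> 'a::metric_space"
  assumes "\<And>s t. s \<in> {0..1} \<Longrightarrow> t \<in> {0..1} \<Longrightarrow> H (s, t) \<in> M"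
    and L1: "\<And>t. t \<in> {0..1} \<Longrightarrow> C-lipschitz_on {0..1} (\<lambda>s. H (s, t))"
    and L2: "\<And>s. s \<in> {0..1} \<Longrightarrow> D-lipschitz_on {0..1} (\<lambda>t. H (s, t))"
    and p: "\<And>s. s \<in> {0..1} \<Longrightarrow> H (s, 0) = p s" and q: "\<And>s. s \<in> {0..1} \<Longrightarrow> H (s, 1) = q s"
    and "\<And>t. t \<in> {0..1} \<Longrightarrow> H (0, t) = p 0" "\<And>t. t \<in> {0..1} \<Longrightarrow> H (1, t) = p 1"
  shows "lip_homotopic M p q"
proof -
  have "C-lipschitz_on {0..1} p"
    using L1[of 0] p by (simp add: lipschitz_on_def)
  moreover have "C-lipschitz_on {0..1} q"
    using L1[of 1] q by (simp add: lipschitz_on_def)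
  moreover have "p s \<in> M" "q s \<in> M" if "s \<in> {0..1}" for s
    using assms(1)[of s 0] assms(1)[of s 1] p[of s] q[of s] that by auto
  moreover have "q 0 = p 0" "q 1 = p 1" using q[of 0] q[of 1] assms(6,7)[of 1] by auto
  moreover have "lip_square (max C D) H"
    by (rule lip_squareI[OF L1 L2])
  moreover have "H \<in> {0..1} \<times> {0..1} \<rightarrow> M"
    using assms(1) by auto
  ultimately show ?thesis
    unfolding lip_homotopic_def lip_path_def pathstart_def pathfinish_def Pi_iff
    using assms(6,7) p q by blast
qed

lemma lip_homotopicD:
  fixes p q :: "real \<Rightarrow> 'a::metric_space"
  assumes "lip_homotopic M p q"
  shows "\<exists>(H :: real \<times> real \<Rightarrow> 'a) C. (\<forall>s\<in>{0..1}. \<forall>t\<in>{0..1}. H (s, t) \<in> M) \<and>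
    (\<forall>t\<in>{0..1}. C-lipschitz_on {0..1} (\<lambda>s. H (s, t))) \<and>
    (\<forall>s\<in>{0..1}. C-lipschitz_on {0..1} (\<lambda>t. H (s, t))) \<and>
    (\<forall>s\<in>{0..1}. H (s, 0) = p s) \<and>
    (\<forall>s\<in>{0..1}. H (s, 1) = q s) \<and>
    (\<forall>t\<in>{0..1}. H (0, t) = p 0) \<and>
    (\<forall>t\<in>{0..1}. H (1, t) = p 1)"
proof -
  obtain H C where F: "H \<in> {0..1} \<times> {0..1} \<rightarrow> M" and L: "lip_square C H"
    and E: "\<forall>s\<in>{0..1}. H (s, 0) = p s" "\<forall>s\<in>{0..1}. H (s, 1) = q s"
      "\<forall>t\<in>{0..1}. H (0, t) = p 0" "\<forall>t\<in>{0..1}. H (1, t) = p 1"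
    using assms unfolding lip_homotopic_def pathstart_def pathfinish_def by blast
  have "\<forall>s\<in>{0..1}. \<forall>t\<in>{0..1}. H (s, t) \<in> M"
    using F by auto
  moreover have "\<forall>t\<in>{0..1}. C-lipschitz_on {0..1} (\<lambda>s. H (s, t))"
    using lip_squareD1[OF L] by blast
  moreover have "\<forall>s\<in>{0..1}. C-lipschitz_on {0..1} (\<lambda>t. H (s, t))"
    using lip_squareD2[OF L] by blast
  ultimately show ?thesis
    using E by - (rule exI[of _ H], rule exI[of _ C], intro conjI)
qed

lemma lip_homotopic_paths:
  assumes "lip_homotopic M p q"
  shows "lip_path M p" "lip_path M q" "pathstart q = pathstart p" "pathfinish q = pathfinish p"
  using assms unfolding lip_homotopic_def by auto

text \<open>Precomposition with two Lipschitz self-maps of the interval that agree at the end points.\<close>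

lemma lip_homotopic_reparam:
  assumes g: "lip_path M g"
    and r: "C-lipschitz_on {0..1} r" "r \<in> {0..1} \<rightarrow> {0..1}"
    and r': "D-lipschitz_on {0..1} r'" "r' \<in> {0..1} \<rightarrow> {0..1}"
    and e: "r 0 = r' 0" "r 1 = r' 1"
    and p: "\<And>s. s \<in> {0..1} \<Longrightarrow> p s = g (r s)" and q: "\<And>s. s \<in> {0..1} \<Longrightarrow> q s = g (r' s)"
  shows "lip_homotopic M p q"
proof -
  obtain K where gM: "g \<in> {0..1} \<rightarrow> M" and K: "K-lipschitz_on {0..1} g"
    using g unfolding lip_path_def by auto
  define u where "u s t = (1 - t) * r s + t * r' s" for s t :: real
  have u01: "u s t \<in> {0..1}" if "s \<in> {0..1}" "t \<in> {0..1}" for s t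
  proof -
    have "r s \<in> {0..1}" "r' s \<in> {0..1}" using r(2) r'(2) that by auto
    then have "(1 - t) *\<^sub>R r s + t *\<^sub>R r' s \<in> {0..1}"
      using that by (intro convexD) auto
    then show ?thesis by (simp add: u_def)
  qed
  have gu: "(K * L)-lipschitz_on {0..1} (\<lambda>x. g (v x))"
    if "L-lipschitz_on {0..1} v" "v \<in> {0..1} \<rightarrow> {0..1}" for L and v :: "real \<Rightarrow> real"
  proof -
    have "v ` {0..1} \<subseteq> {0..1}" using that(2) by blast
    then show ?thesis
      using lipschitz_on_compose2[OF that(1) lipschitz_on_subset[OF K]]
      by (simp add: mult.commute)
  qed
  show ?thesis
  proof (rule lip_homotopicI[where H = "\<lambda>(s, t). g (u s t)" and C = "K * (C + D)" and D = "K * 1"])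
    fix t :: real assume t: "t \<in> {0..1}"
    have "(C + D)-lipschitz_on {0..1} (\<lambda>s. u s t)"
    proof (rule lipschitz_onI)
      fix x y :: real assume xy: "x \<in> {0..1}" "y \<in> {0..1}"
      have "u x t - u y t = (1 - t) * (r x - r y) + t * (r' x - r' y)"
        by (simp add: u_def algebra_simps)
      then have "\<bar>u x t - u y t\<bar> \<le> \<bar>(1 - t) * (r x - r y)\<bar> + \<bar>t * (r' x - r' y)\<bar>"
        by (simp add: abs_triangle_ineq)
      also have "\<dots> \<le> 1 * \<bar>r x - r y\<bar> + 1 * \<bar>r' x - r' y\<bar>"
        unfolding abs_mult using t by (intro add_mono mult_right_mono) auto
      also have "\<dots> \<le> C * \<bar>x - y\<bar> + D * \<bar>x - y\<bar>"
        using lipschitz_onD[OF r(1) xy] lipschitz_onD[OF r'(1) xy] by (simp add: dist_real_def)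
      finally show "dist (u x t) (u y t) \<le> (C + D) * dist x y"
        by (simp add: dist_real_def distrib_right)
    qed (use lipschitz_on_nonneg[OF r(1)] lipschitz_on_nonneg[OF r'(1)] in simp)
    then show "(K * (C + D))-lipschitz_on {0..1} (\<lambda>s. case (s, t) of (s, t) \<Rightarrow> g (u s t))"
      using gu[of "C + D" "\<lambda>s. u s t"] u01 t by auto
  next
    fix s :: real assume s: "s \<in> {0..1}"
    have "1-lipschitz_on {0..1} (\<lambda>t. u s t)"
    proof (rule lipschitz_onI)
      fix x y :: real
      have "u s x - u s y = (x - y) * (r' s - r s)"
        by (simp add: u_def algebra_simps)
      moreover have "\<bar>r' s - r s\<bar> \<le> 1"
        using funcset_mem[OF r(2) s] funcset_mem[OF r'(2) s] by auto
      ultimately show "dist (u s x) (u s y) \<le> 1 * dist x y"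
        by (simp add: dist_real_def abs_mult mult_left_le)
    qed simp
    then show "(K * 1)-lipschitz_on {0..1} (\<lambda>t. case (s, t) of (s, t) \<Rightarrow> g (u s t))"
      using gu[of 1 "u s"] u01 s by auto
  next
    fix s t :: real assume "s \<in> {0..1}" "t \<in> {0..1}"
    then show "(case (s, t) of (s, t) \<Rightarrow> g (u s t)) \<in> M"
      using funcset_mem[OF gM u01[of s t]] by simp
  next
    fix t :: real
    have "u 0 t = r 0" "u 1 t = r 1" using e by (simp_all add: u_def algebra_simps)
    then show "(case (0, t) of (s, t) \<Rightarrow> g (u s t)) = p 0" "(case (1, t) of (s, t) \<Rightarrow> g (u s t)) = p 1"
      using p[of 0] p[of 1] by simp_all
  next
    fix s :: real assume "s \<in> {0..1}"
    then show "(case (s, 0) of (s, t) \<Rightarrow> g (u s t)) = p s" "(case (s, 1) of (s, t) \<Rightarrow> g (u s t)) = q s"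
      using p[of s] q[of s] by (simp_all add: u_def)
  qed
qed

lemma lip_homotopic_refl: "lip_path M p \<Longrightarrow> lip_homotopic M p p"
  by (rule lip_homotopic_reparam[where r = "\<lambda>x. x" and r' = "\<lambda>x. x"]) (auto intro: lipschitz_on_id)

lemma lip_homotopic_sym:
  assumes "lip_homotopic M p q" shows "lip_homotopic M q p"
proof -
  obtain H C where H0: "\<forall>s\<in>{0..1}. \<forall>t\<in>{0..1::real}. H (s, t) \<in> M"
    "\<forall>t\<in>{0..1}. C-lipschitz_on {0..1} (\<lambda>s. H (s, t))"
    "\<forall>s\<in>{0..1}. C-lipschitz_on {0..1} (\<lambda>t. H (s, t))"
    "\<forall>s\<in>{0..1}. H (s, 0) = p s"
    "\<forall>s\<in>{0..1}. H (s, 1) = q s"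
    "\<forall>t\<in>{0..1}. H (0, t) = p 0"
    "\<forall>t\<in>{0..1}. H (1, t) = p 1"
    using lip_homotopicD[OF assms] by (elim exE conjE)
  note H = H0[rule_format]
  have e: "q 0 = p 0" "q 1 = p 1"
    using lip_homotopic_paths(3,4)[OF assms] by (auto simp: pathstart_def pathfinish_def)
  show ?thesis
  proof (rule lip_homotopicI[where H = "\<lambda>(s, t). H (s, 1 - t)" and C = C and D = C])
    fix s :: real assume "s \<in> {0..1}"
    note L = H(3)[OF this]
    have "C-lipschitz_on {0..1} (\<lambda>t. H (s, 1 - t))"
    proof (rule lipschitz_onI)
      show "dist (H (s, 1 - x)) (H (s, 1 - y)) \<le> C * dist x y" if "x \<in> {0..1}" "y \<in> {0..1}" for x y
        using lipschitz_onD[OF L, of "1 - x" "1 - y"] that by (simp add: dist_real_def abs_minus_commute)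
    qed (rule lipschitz_on_nonneg[OF L])
    then show "C-lipschitz_on {0..1} (\<lambda>t. case (s, t) of (s, t) \<Rightarrow> H (s, 1 - t))"
      by simp
  next
    fix s t :: real assume "s \<in> {0..1}" "t \<in> {0..1}"
    then show "(case (s, t) of (s, t) \<Rightarrow> H (s, 1 - t)) \<in> M"
      using H(1)[of s "1 - t"] by simp
  next
    fix t :: real assume "t \<in> {0..1}"
    then show "C-lipschitz_on {0..1} (\<lambda>s. case (s, t) of (s, t) \<Rightarrow> H (s, 1 - t))"
      using H(2)[of "1 - t"] by simp
  next
    fix s :: real assume "s \<in> {0..1}"
    then show "(case (s, 0) of (s, t) \<Rightarrow> H (s, 1 - t)) = q s"
      "(case (s, 1) of (s, t) \<Rightarrow> H (s, 1 - t)) = p s"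
      using H(4,5)[of s] by simp_all
  next
    fix t :: real assume "t \<in> {0..1}"
    then show "(case (0, t) of (s, t) \<Rightarrow> H (s, 1 - t)) = q 0"
      "(case (1, t) of (s, t) \<Rightarrow> H (s, 1 - t)) = q 1"
      using H(6,7)[of "1 - t"] e by simp_all
  qed
qed

text \<open>Gluing of Lipschitz functions on the interval at its midpoint.\<close>

lemma lipschitz_on_join:
  fixes f g :: "real \<Rightarrow> 'a::metric_space"
  assumes f: "C-lipschitz_on {0..1} f" and g: "C-lipschitz_on {0..1} g" and e: "f 1 = g 0"
  shows "(2 * C)-lipschitz_on {0..1} (\<lambda>x. if x \<le> 1/2 then f (2 * x) else g (2 * x - 1))"
proof (rule lipschitz_on_concat)
  have a: "\<bar>2 * x - 2 * y\<bar> = 2 * \<bar>x - y\<bar>" for x y :: real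
    by (simp add: abs_if)
  show "(2 * C)-lipschitz_on {0..1/2} (\<lambda>x. f (2 * x))"
  proof (rule lipschitz_onI)
    show "dist (f (2 * x)) (f (2 * y)) \<le> 2 * C * dist x y" if "x \<in> {0..1/2}" "y \<in> {0..1/2}" for x y
      using lipschitz_onD[OF f, of "2 * x" "2 * y"] that by (simp add: dist_real_def a mult.assoc mult.left_commute[of C 2])
  qed (use lipschitz_on_nonneg[OF f] in simp)
  show "(2 * C)-lipschitz_on {1/2..1} (\<lambda>x. g (2 * x - 1))"
  proof (rule lipschitz_onI)
    show "dist (g (2 * x - 1)) (g (2 * y - 1)) \<le> 2 * C * dist x y"
      if "x \<in> {1/2..1}" "y \<in> {1/2..1}" for x y
      using lipschitz_onD[OF g, of "2 * x - 1" "2 * y - 1"] that by (simp add: dist_real_def a mult.assoc mult.left_commute[of C 2])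
  qed (use lipschitz_on_nonneg[OF g] in simp)
qed (use e in auto)

lemma lip_homotopic_trans:
  assumes "lip_homotopic M p q" "lip_homotopic M q r" shows "lip_homotopic M p r"
proof -
  obtain H C where H0: "\<forall>s\<in>{0..1}. \<forall>t\<in>{0..1::real}. H (s, t) \<in> M"
    "\<forall>t\<in>{0..1}. C-lipschitz_on {0..1} (\<lambda>s. H (s, t))"
    "\<forall>s\<in>{0..1}. C-lipschitz_on {0..1} (\<lambda>t. H (s, t))"
    "\<forall>s\<in>{0..1}. H (s, 0) = p s"
    "\<forall>s\<in>{0..1}. H (s, 1) = q s"
    "\<forall>t\<in>{0..1}. H (0, t) = p 0"
    "\<forall>t\<in>{0..1}. H (1, t) = p 1"
    using lip_homotopicD[OF assms(1)] by (elim exE conjE)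
  note H = H0[rule_format]
  obtain G D where G0: "\<forall>s\<in>{0..1}. \<forall>t\<in>{0..1::real}. G (s, t) \<in> M"
    "\<forall>t\<in>{0..1}. D-lipschitz_on {0..1} (\<lambda>s. G (s, t))"
    "\<forall>s\<in>{0..1}. D-lipschitz_on {0..1} (\<lambda>t. G (s, t))"
    "\<forall>s\<in>{0..1}. G (s, 0) = q s"
    "\<forall>s\<in>{0..1}. G (s, 1) = r s"
    "\<forall>t\<in>{0..1}. G (0, t) = q 0"
    "\<forall>t\<in>{0..1}. G (1, t) = q 1"
    using lip_homotopicD[OF assms(2)] by (elim exE conjE)
  note G = G0[rule_format]
  have e: "q 0 = p 0" "q 1 = p 1"
    using lip_homotopic_paths(3,4)[OF assms(1)] by (auto simp: pathstart_def pathfinish_def)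
  let ?F = "\<lambda>(s, t). if t \<le> 1/2 then H (s, 2 * t) else G (s, 2 * t - 1)"
  let ?K = "max C D"
  show ?thesis
  proof (rule lip_homotopicI[where H = ?F and C = ?K and D = "2 * ?K"])
    fix t :: real assume "t \<in> {0..1}"
    then show "(?K)-lipschitz_on {0..1} (\<lambda>s. ?F (s, t))"
      using lipschitz_on_mono[OF H(2)[of "2 * t"] order_refl, of ?K]
        lipschitz_on_mono[OF G(2)[of "2 * t - 1"] order_refl, of ?K]
      by (cases "t \<le> 1/2") auto
  next
    fix s :: real assume "s \<in> {0..1}"
    then show "(2 * ?K)-lipschitz_on {0..1} (\<lambda>t. ?F (s, t))"
      using lipschitz_on_join[OF lipschitz_on_mono[OF H(3)[of s] order_refl, of ?K]
          lipschitz_on_mono[OF G(3)[of s] order_refl, of ?K]]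
      by (auto simp: H(5) G(4))
  next
    fix s t :: real assume "s \<in> {0..1}" "t \<in> {0..1}"
    then show "?F (s, t) \<in> M"
      using H(1)[of s "2 * t"] G(1)[of s "2 * t - 1"] by simp
  next
    fix s :: real assume "s \<in> {0..1}"
    then show "?F (s, 0) = p s" "?F (s, 1) = r s"
      using H(4)[of s] G(5)[of s] by simp_all
  next
    fix t :: real assume "t \<in> {0..1}"
    then show "?F (0, t) = p 0" "?F (1, t) = p 1"
      using H(6,7)[of "2 * t"] G(6,7)[of "2 * t - 1"] e by simp_all
  qed
qed

lemma lip_path_join:
  assumes "lip_path M p" "lip_path M q" "pathfinish p = pathstart q"
  shows "lip_path M (p +++ q)"
proof -
  obtain C D where "C-lipschitz_on {0..1} p" "D-lipschitz_on {0..1} q"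
    using assms unfolding lip_path_def by auto
  then have "(max C D)-lipschitz_on {0..1} p" "(max C D)-lipschitz_on {0..1} q"
    by (auto intro: lipschitz_on_mono)
  from lipschitz_on_join[OF this] assms(3)
  have "(2 * max C D)-lipschitz_on {0..1} (p +++ q)"
    unfolding joinpaths_def pathstart_def pathfinish_def by blast
  moreover have "p +++ q \<in> {0..1} \<rightarrow> M"
    using assms(1,2) by (auto simp: lip_path_def joinpaths_def Pi_iff)
  ultimately show ?thesis
    unfolding lip_path_def by blast
qed

lemma lip_homotopic_join:
  assumes "lip_homotopic M p p'" "lip_homotopic M q q'" "pathfinish p = pathstart q"
  shows "lip_homotopic M (p +++ q) (p' +++ q')"
proof -
  obtain H C where H0: "\<forall>s\<in>{0..1}. \<forall>t\<in>{0..1::real}. H (s, t) \<in> M"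
    "\<forall>t\<in>{0..1}. C-lipschitz_on {0..1} (\<lambda>s. H (s, t))"
    "\<forall>s\<in>{0..1}. C-lipschitz_on {0..1} (\<lambda>t. H (s, t))"
    "\<forall>s\<in>{0..1}. H (s, 0) = p s"
    "\<forall>s\<in>{0..1}. H (s, 1) = p' s"
    "\<forall>t\<in>{0..1}. H (0, t) = p 0"
    "\<forall>t\<in>{0..1}. H (1, t) = p 1"
    using lip_homotopicD[OF assms(1)] by (elim exE conjE)
  note H = H0[rule_format]
  obtain G D where G0: "\<forall>s\<in>{0..1}. \<forall>t\<in>{0..1::real}. G (s, t) \<in> M"
    "\<forall>t\<in>{0..1}. D-lipschitz_on {0..1} (\<lambda>s. G (s, t))"
    "\<forall>s\<in>{0..1}. D-lipschitz_on {0..1} (\<lambda>t. G (s, t))"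
    "\<forall>s\<in>{0..1}. G (s, 0) = q s"
    "\<forall>s\<in>{0..1}. G (s, 1) = q' s"
    "\<forall>t\<in>{0..1}. G (0, t) = q 0"
    "\<forall>t\<in>{0..1}. G (1, t) = q 1"
    using lip_homotopicD[OF assms(2)] by (elim exE conjE)
  note G = G0[rule_format]
  have e: "p 1 = q 0" using assms(3) by (auto simp: pathstart_def pathfinish_def)
  let ?F = "\<lambda>(s, t). if s \<le> 1/2 then H (2 * s, t) else G (2 * s - 1, t)"
  let ?K = "max C D"
  show ?thesis
  proof (rule lip_homotopicI[where H = ?F and C = "2 * ?K" and D = ?K])
    fix s :: real assume "s \<in> {0..1}"
    then show "(?K)-lipschitz_on {0..1} (\<lambda>t. ?F (s, t))"
      using lipschitz_on_mono[OF H(3)[of "2 * s"] order_refl, of ?K]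
        lipschitz_on_mono[OF G(3)[of "2 * s - 1"] order_refl, of ?K]
      by (cases "s \<le> 1/2") auto
  next
    fix t :: real assume "t \<in> {0..1}"
    then show "(2 * ?K)-lipschitz_on {0..1} (\<lambda>s. ?F (s, t))"
      using lipschitz_on_join[OF lipschitz_on_mono[OF H(2)[of t] order_refl, of ?K]
          lipschitz_on_mono[OF G(2)[of t] order_refl, of ?K]]
      by (auto simp: H(7) G(6) e)
  next
    fix s t :: real assume "s \<in> {0..1}" "t \<in> {0..1}"
    then show "?F (s, t) \<in> M"
      using H(1)[of "2 * s" t] G(1)[of "2 * s - 1" t] by simp
  next
    fix s :: real assume "s \<in> {0..1}"
    then show "?F (s, 0) = (p +++ q) s" "?F (s, 1) = (p' +++ q') s"
      using H(4,5)[of "2 * s"] G(4,5)[of "2 * s - 1"] by (simp_all add: joinpaths_def)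
  next
    fix t :: real assume "t \<in> {0..1}"
    then show "?F (0, t) = (p +++ q) 0" "?F (1, t) = (p +++ q) 1"
      using H(6)[of t] G(7)[of t] by (simp_all add: joinpaths_def)
  qed
qed

lemma lip_homotopic_compose:
  assumes "lip_homotopic M p q" "f \<in> M \<rightarrow> N" "L-lipschitz_on M f"
  shows "lip_homotopic N (f \<circ> p) (f \<circ> q)"
proof -
  obtain H C where H0: "\<forall>s\<in>{0..1}. \<forall>t\<in>{0..1::real}. H (s, t) \<in> M"
    "\<forall>t\<in>{0..1}. C-lipschitz_on {0..1} (\<lambda>s. H (s, t))"
    "\<forall>s\<in>{0..1}. C-lipschitz_on {0..1} (\<lambda>t. H (s, t))"
    "\<forall>s\<in>{0..1}. H (s, 0) = p s"
    "\<forall>s\<in>{0..1}. H (s, 1) = q s"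
    "\<forall>t\<in>{0..1}. H (0, t) = p 0"
    "\<forall>t\<in>{0..1}. H (1, t) = p 1"
    using lip_homotopicD[OF assms(1)] by (elim exE conjE)
  note H = H0[rule_format]
  have c: "(L * C)-lipschitz_on {0..1} (\<lambda>x. f (v x))"
    if "C-lipschitz_on {0..1} v" "\<And>x. x \<in> {0..1} \<Longrightarrow> v x \<in> M" for v :: "real \<Rightarrow> 'a"
  proof -
    have "v ` {0..1} \<subseteq> M" using that(2) by blast
    then show ?thesis
      using lipschitz_on_compose2[OF that(1) lipschitz_on_subset[OF assms(3)]]
      by (simp add: mult.commute)
  qed
  show ?thesis
  proof (rule lip_homotopicI[where H = "f \<circ> H" and C = "L * C" and D = "L * C"])
    fix s t :: real assume "s \<in> {0..1}" "t \<in> {0..1}"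
    then show "(f \<circ> H) (s, t) \<in> N"
      using funcset_mem[OF assms(2) H(1)] by simp
  next
    fix t :: real assume t: "t \<in> {0..1}"
    show "(L * C)-lipschitz_on {0..1} (\<lambda>s. (f \<circ> H) (s, t))"
      using c[OF H(2)[OF t] H(1)[OF _ t]] by simp
    show "(f \<circ> H) (0, t) = (f \<circ> p) 0" "(f \<circ> H) (1, t) = (f \<circ> p) 1"
      using H(6,7)[OF t] by simp_all
  next
    fix s :: real assume s: "s \<in> {0..1}"
    show "(L * C)-lipschitz_on {0..1} (\<lambda>t. (f \<circ> H) (s, t))"
      using c[OF H(3)[OF s] H(1)[OF s]] by simp
    show "(f \<circ> H) (s, 0) = (f \<circ> p) s" "(f \<circ> H) (s, 1) = (f \<circ> q) s"
      using H(4,5)[OF s] by simp_all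
  qed
qed

lemma lip_class_eq:
  assumes "lip_homotopic M p q" shows "lip_class M p = lip_class M q"
  using assms lip_homotopic_sym[OF assms]
  by (auto simp: lip_class_def intro: lip_homotopic_trans)

lemma lip_class_self: "lip_path M p \<Longrightarrow> p \<in> lip_class M p"
  by (simp add: lip_class_def lip_homotopic_refl)

lemma lip_class_eq_iff:
  assumes "lip_path M q" shows "lip_class M p = lip_class M q \<longleftrightarrow> lip_homotopic M p q"
proof
  assume "lip_class M p = lip_class M q"
  then have "q \<in> lip_class M p" using lip_class_self[OF assms] by simp
  then show "lip_homotopic M p q" by (simp add: lip_class_def)
qed (rule lip_class_eq)

lemma lip_loops_join: "\<alpha> \<in> lip_loops M p \<Longrightarrow> \<beta> \<in> lip_loops M p \<Longrightarrow> \<alpha> +++ \<beta> \<in> lip_loops M p"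
  by (simp add: lip_loops_def lip_path_join)

lemma lip_pi1_mult:
  assumes "\<alpha> \<in> lip_loops M p" "\<beta> \<in> lip_loops M p"
  shows "lip_class M \<alpha> \<otimes>\<^bsub>lip_pi1 M p\<^esub> lip_class M \<beta> = lip_class M (\<alpha> +++ \<beta>)"
proof -
  have "lip_class M (\<alpha>' +++ \<beta>') = lip_class M (\<alpha> +++ \<beta>)"
    if "\<alpha>' \<in> lip_class M \<alpha>" "\<beta>' \<in> lip_class M \<beta>" for \<alpha>' \<beta>'
    using that assms lip_homotopic_join[of M \<alpha> \<alpha>' \<beta> \<beta>']
    by (intro lip_class_eq[symmetric]) (auto simp: lip_class_def lip_loops_def)
  then have "(\<Union>\<alpha>'\<in>lip_class M \<alpha>. \<Union>\<beta>'\<in>lip_class M \<beta>. lip_class M (\<alpha>' +++ \<beta>'))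
      = (\<Union>\<alpha>'\<in>lip_class M \<alpha>. \<Union>\<beta>'\<in>lip_class M \<beta>. lip_class M (\<alpha> +++ \<beta>))"
    by (intro SUP_cong refl)
  moreover have "lip_class M \<alpha> \<noteq> {}" "lip_class M \<beta> \<noteq> {}"
    using assms lip_class_self[of M \<alpha>] lip_class_self[of M \<beta>] by (auto simp: lip_loops_def)
  ultimately show ?thesis by (simp add: lip_pi1_def)
qed

lemma lip_induced_class:
  assumes "lip_path M \<alpha>" "f \<in> M \<rightarrow> N" "L-lipschitz_on M f"
  shows "lip_induced N f (lip_class M \<alpha>) = lip_class N (f \<circ> \<alpha>)"
proof -
  have "lip_class N (f \<circ> \<alpha>') = lip_class N (f \<circ> \<alpha>)" if "\<alpha>' \<in> lip_class M \<alpha>" for \<alpha>'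
    using that lip_homotopic_compose[OF _ assms(2,3)]
    by (intro lip_class_eq[symmetric]) (auto simp: lip_class_def)
  then have "(\<Union>\<alpha>'\<in>lip_class M \<alpha>. lip_class N (f \<circ> \<alpha>')) = (\<Union>\<alpha>'\<in>lip_class M \<alpha>. lip_class N (f \<circ> \<alpha>))"
    by (intro SUP_cong refl)
  moreover have "lip_class M \<alpha> \<noteq> {}"
    using lip_class_self[OF assms(1)] by auto
  ultimately show ?thesis by (simp add: lip_induced_def)
qed

lemma lip_loops_reversepath:
  assumes "\<alpha> \<in> lip_loops M p" shows "reversepath \<alpha> \<in> lip_loops M p"
proof -
  obtain C where \<alpha>: "\<alpha> \<in> {0..1} \<rightarrow> M" and C: "C-lipschitz_on {0..1} \<alpha>"
    using assms by (auto simp: lip_loops_def lip_path_def)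
  have "C-lipschitz_on {0..1} (reversepath \<alpha>)"
  proof (rule lipschitz_onI)
    show "dist (reversepath \<alpha> x) (reversepath \<alpha> y) \<le> C * dist x y"
      if "x \<in> {0..1}" "y \<in> {0..1}" for x y
      using lipschitz_onD[OF C, of "1 - x" "1 - y"] that
      by (simp add: reversepath_def dist_real_def abs_minus_commute)
  qed (rule lipschitz_on_nonneg[OF C])
  moreover have "reversepath \<alpha> \<in> {0..1} \<rightarrow> M"
    using \<alpha> by (auto simp: reversepath_def Pi_iff)
  ultimately show ?thesis
    using assms by (auto simp: lip_loops_def lip_path_def)
qed

lemma group_lip_pi1:
  assumes "p \<in> M" shows "group (lip_pi1 M p)"
proof (rule groupI)
  have loop0: "(\<lambda>_. p) \<in> lip_loops M p"
    using assms by (auto simp: lip_loops_def lip_path_def pathstart_def pathfinish_def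
        intro!: exI[of _ 0] lipschitz_on_constant)
  have car: "carrier (lip_pi1 M p) = lip_class M ` lip_loops M p"
    and one: "\<one>\<^bsub>lip_pi1 M p\<^esub> = lip_class M (\<lambda>_. p)"
    by (simp_all add: lip_pi1_def)
  show "\<one>\<^bsub>lip_pi1 M p\<^esub> \<in> carrier (lip_pi1 M p)"
    using loop0 by (simp add: car one)
  fix x assume "x \<in> carrier (lip_pi1 M p)"
  then obtain \<alpha> where \<alpha>: "\<alpha> \<in> lip_loops M p" "x = lip_class M \<alpha>" by (auto simp: car)
  have \<alpha>': "lip_path M \<alpha>" "\<alpha> 0 = p" "\<alpha> 1 = p"
    using \<alpha> by (auto simp: lip_loops_def pathstart_def pathfinish_def)
  have "lip_homotopic M ((\<lambda>_. p) +++ \<alpha>) \<alpha>"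
  proof (rule lip_homotopic_reparam[where g = \<alpha> and r = "\<lambda>s. max 0 (2 * s - 1)" and r' = "\<lambda>s. s"
        and C = 2 and D = 1])
    show "2-lipschitz_on {0..1} (\<lambda>s::real. max 0 (2 * s - 1))"
      by (auto simp: lipschitz_on_def dist_real_def max_def abs_if)
    show "((\<lambda>_. p) +++ \<alpha>) s = \<alpha> (max 0 (2 * s - 1))" for s
      using \<alpha>' by (cases "s \<le> 1/2") (auto simp: joinpaths_def max_absorb1 max_absorb2)
  qed (use \<alpha>' in \<open>auto intro: lipschitz_on_id\<close>)
  then show "\<one>\<^bsub>lip_pi1 M p\<^esub> \<otimes>\<^bsub>lip_pi1 M p\<^esub> x = x"
    using \<alpha> loop0 by (simp add: one lip_pi1_mult lip_class_eq)
  have "lip_homotopic M (reversepath \<alpha> +++ \<alpha>) (\<lambda>_. p)"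
  proof (rule lip_homotopic_reparam[where g = \<alpha> and r = "\<lambda>s. \<bar>2 * s - 1\<bar>" and r' = "\<lambda>s. 1"
        and C = 2 and D = 0])
    show "2-lipschitz_on {0..1} (\<lambda>s::real. \<bar>2 * s - 1\<bar>)"
      by (auto simp: lipschitz_on_def dist_real_def abs_if)
    show "(reversepath \<alpha> +++ \<alpha>) s = \<alpha> \<bar>2 * s - 1\<bar>" for s
    proof (cases "s \<le> 1/2")
      case True
      then have "\<bar>2 * s - 1\<bar> = 1 - 2 * s" by simp
      with True show ?thesis by (simp add: joinpaths_def reversepath_def)
    qed (simp add: joinpaths_def)
  qed (use \<alpha>' in \<open>auto intro: lipschitz_on_constant\<close>)
  then show "\<exists>y\<in>carrier (lip_pi1 M p). y \<otimes>\<^bsub>lip_pi1 M p\<^esub> x = \<one>\<^bsub>lip_pi1 M p\<^esub>"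
    using \<alpha> lip_loops_reversepath[of \<alpha> M p]
    by (auto simp: one car lip_pi1_mult lip_class_eq intro!: bexI[of _ "reversepath \<alpha>"])
  fix y assume "y \<in> carrier (lip_pi1 M p)"
  then obtain \<beta> where \<beta>: "\<beta> \<in> lip_loops M p" "y = lip_class M \<beta>" by (auto simp: car)
  show "x \<otimes>\<^bsub>lip_pi1 M p\<^esub> y \<in> carrier (lip_pi1 M p)"
    using \<alpha> \<beta> by (simp add: car lip_pi1_mult lip_loops_join)
  fix z assume "z \<in> carrier (lip_pi1 M p)"
  then obtain \<gamma> where \<gamma>: "\<gamma> \<in> lip_loops M p" "z = lip_class M \<gamma>" by (auto simp: car)
  have ends: "\<alpha> 1 = \<beta> 0" "\<beta> 1 = \<gamma> 0" 
    using \<alpha>(1) \<beta>(1) \<gamma>(1) by (auto simp: lip_loops_def pathstart_def pathfinish_def)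
  have "lip_homotopic M ((\<alpha> +++ \<beta>) +++ \<gamma>) (\<alpha> +++ (\<beta> +++ \<gamma>))"
  proof (rule lip_homotopic_reparam[where g = "(\<alpha> +++ \<beta>) +++ \<gamma>" and r = "\<lambda>s. s"
        and r' = "\<lambda>s. max (s/2) (max (s - 1/4) (2 * s - 1))" and C = 1 and D = 2])
    show "lip_path M ((\<alpha> +++ \<beta>) +++ \<gamma>)"
      using lip_loops_join[OF lip_loops_join[OF \<alpha>(1) \<beta>(1)] \<gamma>(1)] by (simp add: lip_loops_def)
    show "2-lipschitz_on {0..1} (\<lambda>s::real. max (s/2) (max (s - 1/4) (2 * s - 1)))"
      by (auto simp: lipschitz_on_def dist_real_def max_def abs_if)
    fix s :: real assume "s \<in> {0..1}"
    then consider "s \<le> 1/2" | "1/2 < s" "s \<le> 3/4" | "3/4 < s" "s \<le> 1" by fastforce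
    then show "(\<alpha> +++ (\<beta> +++ \<gamma>)) s
        = ((\<alpha> +++ \<beta>) +++ \<gamma>) (max (s/2) (max (s - 1/4) (2 * s - 1)))"
    proof cases
      case 1
      then have "max (s/2) (max (s - 1/4) (2 * s - 1)) = s/2" by simp
      with 1 show ?thesis by (simp add: joinpaths_def)
    next
      case 2
      then have "max (s/2) (max (s - 1/4) (2 * s - 1)) = s - 1/4" by simp
      with 2 show ?thesis by (simp add: joinpaths_def)
    next
      case 3
      then have "max (s/2) (max (s - 1/4) (2 * s - 1)) = 2 * s - 1" by simp
      with 3 show ?thesis by (simp add: joinpaths_def)
    qed
  qed (auto simp: lipschitz_on_def max_def)
  then show "x \<otimes>\<^bsub>lip_pi1 M p\<^esub> y \<otimes>\<^bsub>lip_pi1 M p\<^esub> z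
      = x \<otimes>\<^bsub>lip_pi1 M p\<^esub> (y \<otimes>\<^bsub>lip_pi1 M p\<^esub> z)"
    using \<alpha> \<beta> \<gamma> by (simp add: lip_pi1_mult lip_loops_join lip_class_eq)
qed

lemma lip_induced_hom:
  assumes f: "f \<in> M \<rightarrow> N" "L-lipschitz_on M f" and q: "f p = q"
  shows "lip_induced N f \<in> hom (lip_pi1 M p) (lip_pi1 N q)"
proof -
  have car: "carrier (lip_pi1 M p) = lip_class M ` lip_loops M p"
    "carrier (lip_pi1 N q) = lip_class N ` lip_loops N q"
    by (simp_all add: lip_pi1_def)
  have loop: "f \<circ> \<alpha> \<in> lip_loops N q" if "\<alpha> \<in> lip_loops M p" for \<alpha>
    using that q lip_homotopic_paths(1)[OF lip_homotopic_compose[OF lip_homotopic_refl f]]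
    by (auto simp: lip_loops_def pathstart_def pathfinish_def)
  have ind: "lip_induced N f (lip_class M \<alpha>) = lip_class N (f \<circ> \<alpha>)" if "\<alpha> \<in> lip_loops M p" for \<alpha>
    using that lip_induced_class[OF _ f] by (simp add: lip_loops_def)
  show ?thesis
    unfolding hom_def car
    by (auto simp: ind loop lip_pi1_mult lip_loops_join path_compose_join)
qed

end

theory Submission
  imports Defs "HOL-Algebra.Coset"
begin

text \<open>A homomorphism of groups is injective if its kernel is trivial, so let \<open>\<alpha>\<close> be a loop in \<open>X\<close>
  and \<open>H\<close> a Lipschitz null homotopy of \<open>\<phi> \<circ> \<alpha>\<close> in \<open>Y\<close>. The idea is that \<open>H\<close> has no area, and a
  disc without area must collapse to a tree; a loop that runs through a tree can be contracted
  inside its own image by retracting the tree to its root. The contraction uses only values of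
  \<open>\<phi> \<circ> \<alpha>\<close>, so it can be carried out in \<open>X\<close>, and the Lipschitz constant is that of \<open>\<alpha>\<close>.

  The tree itself never appears. It is replaced by the relation that it induces on the bottom
  side of the square, on which \<open>H\<close> is the loop: two points are tied if they can be joined in the
  square by paths along which \<open>H\<close> is as nearly constant as desired. Such a relation behaves like
  the gluing of an interval to a tree if it ties the two ends and satisfies three conditions. It is closed; it is
  unlinked, since two paths in the square whose ends interlace on the bottom side must meet
  (\<open>tied_cross\<close>); and it has no gaps: between two nested tied pairs with different values of the
  loop there is a third one (\<open>tied_gap\<close>). The contraction constructed from these conditions is
  \<open>lip_nullhomotopic_of_lamination\<close>.

  The absence of gaps is where pure 2-unrectifiability enters. The image of \<open>H\<close> has
  Hausdorff 2-measure zero. By slicing it with spheres around a point, in the manner of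
  Eilenberg's inequality, almost every slice has 1-dimensional measure zero and so contains no
  connected set with more than one point (\<open>AE_connected_sphere_subset_trivial\<close>). The preimage of a
  sphere that separates the values at two nested pairs separates these pairs in the plane; then
  one connected component of this preimage separates them. It meets the bottom side in between,
  on the left and on the right, and \<open>H\<close> is constant on it, so its two points there are tied.\<close>

section \<open>Spherical slices of sets of Hausdorff 2-measure zero\<close>

text \<open>Cover \<open>S\<close> by sets \<open>U i\<close> of diameters \<open>d i\<close> with a small sum of squares. The radii of the spheres
  that meet \<open>U i\<close> lie in an interval of length at most \<open>2 * d i\<close>, so the integral over all radii of
  the sum of the diameters of the sets that meet the sphere is small as well. A connected set
  with two distinct points bounds this sum from below, since its distances from one of its
  points fill an interval.\<close>

lemma AE_connected_sphere_subset_trivial: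
  fixes S :: "'a::metric_space set" and y :: 'a
  assumes "hausdorff2 S = 0"
  shows "AE r in lborel. \<forall>C p q. connected C \<longrightarrow> C \<subseteq> S \<inter> sphere y r \<longrightarrow> p \<in> C \<longrightarrow> q \<in> C \<longrightarrow> p = q"
proof -
  \<comment> \<open>The bounds are summable in \<open>n\<close>, so that almost everywhere convergence comes from the
      finiteness of the integral of a single function.\<close>
  have "\<exists>U::nat \<Rightarrow> 'a set. S \<subseteq> (\<Union>i. U i) \<and> (\<forall>i. bounded (U i)) \<and>
      (\<Sum>i. ennreal (pi / 4 * diameter (U i) ^ 2)) < ennreal ((1/2) ^ n)" for n :: nat
  proof -
    have "hausdorff2_pre 1 S \<le> hausdorff2 S"
      unfolding hausdorff2_def by (rule SUP_upper) simp
    then have "hausdorff2_pre 1 S < ennreal ((1/2) ^ n)"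
      using assms by simp
    then show ?thesis unfolding hausdorff2_pre_def INF_less_iff by blast
  qed
  then obtain U :: "nat \<Rightarrow> nat \<Rightarrow> 'a set" where U: "\<And>n. S \<subseteq> (\<Union>i. U n i)"
    "\<And>n i. bounded (U n i)"
    "\<And>n. (\<Sum>i. ennreal (pi / 4 * diameter (U n i) ^ 2)) < ennreal ((1/2) ^ n)"
    by metis
  define x where "x n i = (SOME x. x \<in> U n i)" for n i
  have x: "x n i \<in> U n i" if "z \<in> U n i" for n i z
    unfolding x_def using that by (rule someI)
  define d where "d n i = diameter (U n i)" for n i
  have d0: "0 \<le> d n i" for n i
    unfolding d_def using U(2) by (rule diameter_ge_0)
  have dU: "dist z (x n i) \<le> d n i" if "z \<in> U n i" for n i z
    unfolding d_def using U(2) that x[OF that] by (rule diameter_bounded_bound)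
  define J where "J n i = {dist (x n i) y - d n i .. dist (x n i) y + d n i}" for n i
  \<comment> \<open>The constant makes the integral of each term over \<open>r\<close> exactly the term
      \<open>pi / 4 * d n i ^ 2\<close> of the Hausdorff sum.\<close>
  define g where "g n r = (\<Sum>i. ennreal (pi / 8 * d n i) * indicator (J n i) r)" for n r
  have gm [measurable]: "g n \<in> borel_measurable lborel" for n
    unfolding g_def J_def by measurable
  have "(\<integral>\<^sup>+ r. g n r \<partial>lborel) \<le> ennreal ((1/2) ^ n)" for n
  proof -
    have "(\<integral>\<^sup>+ r. g n r \<partial>lborel) = (\<Sum>i. \<integral>\<^sup>+ r. ennreal (pi / 8 * d n i) * indicator (J n i) r \<partial>lborel)"
      unfolding g_def by (rule nn_integral_suminf) (simp add: J_def)
    also have "\<dots> = (\<Sum>i. ennreal (pi / 4 * d n i ^ 2))"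
    proof (rule suminf_cong)
      fix i
      have "(\<integral>\<^sup>+ r. ennreal (pi / 8 * d n i) * indicator (J n i) r \<partial>lborel)
          = ennreal (pi / 8 * d n i) * ennreal (2 * d n i)"
        using d0[of n i] by (subst nn_integral_cmult_indicator) (auto simp: J_def)
      then show "(\<integral>\<^sup>+ r. ennreal (pi / 8 * d n i) * indicator (J n i) r \<partial>lborel)
          = ennreal (pi / 4 * d n i ^ 2)"
        using d0[of n i] by (simp add: ennreal_mult'[symmetric] power2_eq_square)
    qed
    finally show ?thesis using U(3)[of n] by (simp add: d_def)
  qed
  then have "(\<Sum>n. \<integral>\<^sup>+ r. g n r \<partial>lborel) \<le> (\<Sum>n. ennreal ((1/2) ^ n))"
    by (intro suminf_le) auto
  also have "\<dots> = ennreal 2"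
    using geometric_sums[of "1/2::real"] by (intro suminf_ennreal_eq) auto
  finally have "(\<integral>\<^sup>+ r. (\<Sum>n. g n r) \<partial>lborel) \<noteq> \<infinity>"
    by (subst nn_integral_suminf) (auto simp: top_unique)
  then have "AE r in lborel. (\<Sum>n. g n r) \<noteq> \<infinity>"
    by (intro nn_integral_PInf_AE) auto
  then show ?thesis
  proof (rule AE_mp, intro AE_I2 impI allI)
    fix r C p q
    assume r: "(\<Sum>n. g n r) \<noteq> \<infinity>" and C: "connected C" "C \<subseteq> S \<inter> sphere y r" "p \<in> C" "q \<in> C"
    show "p = q"
    proof (rule ccontr)
      assume "p \<noteq> q"
      \<comment> \<open>Distances from \<open>p\<close> on \<open>C\<close> are covered by intervals of length \<open>2 * d n i\<close>, which is
          \<open>16 / pi\<close> times the weight \<open>pi / 8 * d n i\<close> in \<open>g\<close>.\<close>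
      define k where "k = pi / 16 * dist p q"
      have k: "0 < k" using \<open>p \<noteq> q\<close> by (simp add: k_def)
      have "ennreal k \<le> g n r" for n
      proof -
        define K where "K i = (if r \<in> J n i then {dist p (x n i) - d n i .. dist p (x n i) + d n i} else {})" for i
        have "{0..dist p q} \<subseteq> (\<Union>i. K i)"
        proof
          fix t assume "t \<in> {0..dist p q}"
          moreover have "connected (dist p ` C)"
            by (intro connected_continuous_image continuous_intros C)
          moreover have "0 \<in> dist p ` C"
            using C(3) by (rule image_eqI[rotated]) simp
          moreover have "dist p q \<in> dist p ` C"
            using C(4) by (rule imageI)
          ultimately have "t \<in> dist p ` C"
            using connected_contains_Icc[of "dist p ` C" 0 "dist p q"] by auto
          then obtain z where z: "z \<in> C" "t = dist p z" by auto
          then obtain i where i: "z \<in> U n i" using C U(1)[of n] by blast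
          have "dist y z = r" using z C by auto
          then have "r \<in> J n i"
            using dU[OF i] dist_triangle[of z y "x n i"] dist_triangle[of "x n i" y z]
            by (auto simp: J_def dist_commute)
          moreover have "t \<in> {dist p (x n i) - d n i .. dist p (x n i) + d n i}"
            using dU[OF i] dist_triangle[of p z "x n i"] dist_triangle[of p "x n i" z] z
            by (auto simp: dist_commute)
          ultimately show "t \<in> (\<Union>i. K i)" by (auto simp: K_def)
        qed
        then have "emeasure lborel {0..dist p q} \<le> emeasure lborel (\<Union>i. K i)"
          by (intro emeasure_mono) (auto simp: K_def)
        also have "\<dots> \<le> (\<Sum>i. emeasure lborel (K i))"
          by (rule emeasure_subadditive_countably) (auto simp: K_def)
        also have "\<dots> = (\<Sum>i. ennreal (16 / pi) * (ennreal (pi / 8 * d n i) * indicator (J n i) r))"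
        proof (rule suminf_cong)
          fix i show "emeasure lborel (K i) = ennreal (16 / pi) * (ennreal (pi / 8 * d n i) * indicator (J n i) r)"
            using d0[of n i] by (auto simp: K_def ennreal_mult'[symmetric])
        qed
        also have "\<dots> = ennreal (16 / pi) * g n r"
          by (simp add: g_def)
        finally have "ennreal (pi / 16) * ennreal (dist p q) \<le> ennreal (pi / 16) * (ennreal (16 / pi) * g n r)"
          by (intro mult_left_mono) auto
        also have "\<dots> = g n r"
          by (simp add: mult.assoc[symmetric] ennreal_mult'[symmetric])
        finally show ?thesis by (simp add: k_def ennreal_mult'[symmetric])
      qed
      then have "(\<Sum>n. ennreal k) \<le> (\<Sum>n. g n r)"
        by (intro suminf_le) auto
      moreover have "(\<Sum>n::nat. ennreal k) = \<infinity>"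
        using k by (simp add: nn_integral_count_space_nat[symmetric] ennreal_mult_top)
      ultimately show False using r by (simp add: top_unique)
    qed
  qed
qed

lemma obtain_sphere_with_trivial_connected_subsets:
  fixes S :: "'a::metric_space set" and y :: 'a
  assumes "hausdorff2 S = 0" "a < b"
  obtains r where "a < r" "r < b"
    "\<And>C p q. connected C \<Longrightarrow> C \<subseteq> S \<inter> sphere y r \<Longrightarrow> p \<in> C \<Longrightarrow> q \<in> C \<Longrightarrow> p = q"
proof -
  have "\<exists>r\<in>{a<..<b}. \<forall>C p q. connected C \<longrightarrow> C \<subseteq> S \<inter> sphere y r \<longrightarrow> p \<in> C \<longrightarrow> q \<in> C \<longrightarrow> p = q"
  proof (rule ccontr)
    assume *: "\<not> ?thesis"
    have "AE r in lborel. r \<notin> {a<..<b}"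
      using AE_connected_sphere_subset_trivial[OF assms(1), of y]
    proof (rule AE_mp, intro AE_I2 impI)
      fix r assume "\<forall>C p q. connected C \<longrightarrow> C \<subseteq> S \<inter> sphere y r \<longrightarrow> p \<in> C \<longrightarrow> q \<in> C \<longrightarrow> p = q"
      with * show "r \<notin> {a<..<b}" by blast
    qed
    then have "{a<..<b} \<in> null_sets lborel"
      by (simp add: AE_iff_null_sets)
    then show False using assms(2) by (auto simp: null_sets_def)
  qed
  then show ?thesis using that by auto
qed

section \<open>Contracting a loop along an unlinked relation\<close>

text \<open>Think of the quotient of the interval by \<open>R\<close> as a tree whose root is the class of the ends.
  The set \<open>A s\<close> consists of \<open>s\<close> and of all later points that are related to a point up to \<open>s\<close>; these
  are the points at which the loop, run from \<open>s\<close> to the end, crosses the branch from \<open>s\<close> to the root.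
  The homotopy moves \<open>s\<close> along this branch: at time \<open>t\<close> it takes the value at the first point of
  \<open>A s\<close> after \<open>t\<close>. By the condition on gaps \<open>\<alpha>\<close> has equal values at the two ends of each interval
  that \<open>A s\<close> omits, so that this is as continuous as \<open>\<alpha>\<close>.\<close>

lemma lip_nullhomotopic_of_lamination:
  fixes \<alpha> :: "real \<Rightarrow> 'a::metric_space" and R :: "real \<Rightarrow> real \<Rightarrow> bool"
  assumes path: "lip_path M \<alpha>"
    and refl: "\<And>s. 0 \<le> s \<Longrightarrow> s \<le> 1 \<Longrightarrow> R s s"
    and ends: "R 0 1"
    and closed: "closed {(s, t). 0 \<le> s \<and> s \<le> t \<and> t \<le> 1 \<and> R s t}"
    and eq: "\<And>s t. 0 \<le> s \<Longrightarrow> s \<le> t \<Longrightarrow> t \<le> 1 \<Longrightarrow> R s t \<Longrightarrow> \<alpha> s = \<alpha> t"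
    and cross: "\<And>a b c d. 0 \<le> a \<Longrightarrow> a < b \<Longrightarrow> b \<le> c \<Longrightarrow> c < d \<Longrightarrow> d \<le> 1 \<Longrightarrow> R a c \<Longrightarrow> R b d \<Longrightarrow> R a d"
    and gap: "\<And>a b c d. 0 \<le> a \<Longrightarrow> a < b \<Longrightarrow> b \<le> c \<Longrightarrow> c < d \<Longrightarrow> d \<le> 1 \<Longrightarrow> R a d \<Longrightarrow> R b c \<Longrightarrow>
        \<alpha> c \<noteq> \<alpha> d \<Longrightarrow> \<exists>x y. a < x \<and> x < b \<and> c < y \<and> y < d \<and> R x y"
  shows "lip_homotopic M \<alpha> (\<lambda>_. \<alpha> 1)"
proof -
  obtain L where \<alpha>M: "\<alpha> \<in> {0..1} \<rightarrow> M" and L: "L-lipschitz_on {0..1} \<alpha>"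
    using path unfolding lip_path_def by auto
  have L0: "0 \<le> L" by (rule lipschitz_on_nonneg[OF L])
  have Ld: "dist (\<alpha> u) (\<alpha> v) \<le> L * (b - a)"
    if "a \<le> u" "u \<le> b" "a \<le> v" "v \<le> b" "0 \<le> a" "b \<le> 1" for a b u v
  proof -
    have "dist (\<alpha> u) (\<alpha> v) \<le> L * \<bar>u - v\<bar>"
      using lipschitz_onD[OF L, of u v] that by (simp add: dist_real_def)
    also have "\<dots> \<le> L * (b - a)"
      using that L0 by (intro mult_left_mono) auto
    finally show ?thesis .
  qed
  define A where "A s = {t. s \<le> t \<and> t \<le> 1 \<and> (\<exists>x. 0 \<le> x \<and> x \<le> s \<and> R x t)}" for s
  have A_start: "s \<in> A s" if "s \<in> {0..1}" for s
    using that refl[of s] by (auto simp: A_def)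
  have A_end: "1 \<in> A s" if "s \<in> {0..1}" for s
    using that ends by (auto simp: A_def)
  have A_closed: "closed (A s)" for s
  proof -
    have "A s = snd ` ({(s, t). 0 \<le> s \<and> s \<le> t \<and> t \<le> 1 \<and> R s t} \<inter> ({0..s} \<times> {s..1}))"
    proof (intro subset_antisym subsetI)
      fix t assume "t \<in> A s"
      then obtain x where "0 \<le> x" "x \<le> s" "s \<le> t" "t \<le> 1" "R x t" by (auto simp: A_def)
      then show "t \<in> snd ` ({(s, t). 0 \<le> s \<and> s \<le> t \<and> t \<le> 1 \<and> R s t} \<inter> ({0..s} \<times> {s..1}))"
        by (intro image_eqI[where x = "(x, t)"]) auto
    qed (auto simp: A_def)
    also have "compact \<dots>"
      by (intro compact_continuous_image continuous_intros closed_Int_compact[OF closed]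
          compact_Times compact_Icc)
    finally show ?thesis by (rule compact_imp_closed)
  qed
  define \<tau> where "\<tau> s t = Inf (A s \<inter> {t..})" for s t
  have \<tau>: "\<tau> s t \<in> A s" "t \<le> \<tau> s t" "\<And>y. y \<in> A s \<Longrightarrow> t \<le> y \<Longrightarrow> \<tau> s t \<le> y"
    if "s \<in> {0..1}" "t \<in> {0..1}" for s t
  proof -
    have b: "bdd_below (A s \<inter> {t..})" by (rule bdd_belowI[of _ t]) auto
    have "A s \<inter> {t..} \<noteq> {}" using A_end[OF that(1)] that by auto
    then have "\<tau> s t \<in> A s \<inter> {t..}"
      unfolding \<tau>_def using b by (intro closed_contains_Inf closed_Int A_closed closed_atLeast)
    then show "\<tau> s t \<in> A s" "t \<le> \<tau> s t" by auto
    show "\<tau> s t \<le> y" if "y \<in> A s" "t \<le> y" for y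
      unfolding \<tau>_def using b that by (intro cInf_lower) auto
  qed
  have A_gap: "\<alpha> u = \<alpha> v" if s: "s \<in> {0..1}" and u: "u \<in> A s" and v: "v \<in> A s" and "u < v"
    and none: "\<And>z. z \<in> A s \<Longrightarrow> z \<le> u \<or> v \<le> z" for s u v
  proof (rule ccontr)
    assume ne: "\<alpha> u \<noteq> \<alpha> v"
    obtain a where a: "0 \<le> a" "a \<le> s" "R a u" "s \<le> u" using u by (auto simp: A_def)
    obtain b where b: "0 \<le> b" "b \<le> s" "R b v" "v \<le> 1" using v by (auto simp: A_def)
    have au: "\<alpha> a = \<alpha> u" and bv: "\<alpha> b = \<alpha> v" using eq[of a u] eq[of b v] a b \<open>u < v\<close> by auto
    consider "a < b" | "a = b" | "b < a" by linarith
    then show False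
    proof cases
      case 1
      then have "R a v" using cross[of a b u v] a b \<open>u < v\<close> by auto
      then have "\<alpha> a = \<alpha> v" using eq[of a v] a b \<open>u < v\<close> by auto
      with au ne show False by simp
    next
      case 2 with au bv ne show False by simp
    next
      case 3
      then obtain x z where xz: "b < x" "x < a" "u < z" "z < v" "R x z"
        using gap[of b a u v] a b \<open>u < v\<close> ne by auto
      then have "z \<in> A s" using a b by (auto simp: A_def intro!: exI[of _ x])
      with none[of z] xz show False by auto
    qed
  qed
  \<comment> \<open>The last point of \<open>A s\<close> before \<open>y\<close> gives the same value of \<open>\<alpha>\<close> as the first one after \<open>y\<close>.\<close>
  have pred: "\<exists>w\<in>A s. w \<le> y \<and> (\<forall>z\<in>A s. z \<le> y \<longrightarrow> z \<le> w) \<and> \<alpha> w = \<alpha> (\<tau> s y)"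
    if s: "s \<in> {0..1}" and y: "s \<le> y" "y \<le> 1" for s y
  proof -
    have y01: "y \<in> {0..1}" using s y by auto
    define w where "w = Sup (A s \<inter> {..y})"
    have b: "bdd_above (A s \<inter> {..y})" by (rule bdd_aboveI[of _ y]) auto
    have "A s \<inter> {..y} \<noteq> {}" using A_start[OF s] y by auto
    then have w: "w \<in> A s \<inter> {..y}"
      unfolding w_def using b by (intro closed_contains_Sup closed_Int A_closed closed_atMost)
    have max: "z \<le> w" if "z \<in> A s" "z \<le> y" for z
      unfolding w_def using b that by (intro cSup_upper) auto
    note t = \<tau>[OF s y01]
    have "\<alpha> w = \<alpha> (\<tau> s y)"
    proof (cases "w < \<tau> s y")
      case True
      have "z \<le> w \<or> \<tau> s y \<le> z" if "z \<in> A s" for z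
        using max[OF that] t(3)[OF that] by linarith
      then show ?thesis using A_gap[OF s _ t(1) True] w by auto
    next
      case False
      then have "w = \<tau> s y" using w t(2) by auto
      then show ?thesis by simp
    qed
    with w max show ?thesis by auto
  qed
  have lip_t: "dist (\<alpha> (\<tau> s x)) (\<alpha> (\<tau> s y)) \<le> L * (y - x)"
    if s: "s \<in> {0..1}" and x: "x \<in> {0..1}" and y: "y \<in> {0..1}" and "x \<le> y" for s x y
  proof (cases "y \<le> \<tau> s x")
    case True
    have "\<tau> s y \<le> \<tau> s x" by (rule \<tau>(3)[OF s y \<tau>(1)[OF s x] True])
    moreover have "\<tau> s x \<le> \<tau> s y"
      using \<tau>(3)[OF s x \<tau>(1)[OF s y]] \<tau>(2)[OF s y] \<open>x \<le> y\<close> by auto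
    ultimately show ?thesis using L0 \<open>x \<le> y\<close> by simp
  next
    case False
    have "s \<le> \<tau> s x" using \<tau>(1)[OF s x] by (auto simp: A_def)
    then obtain w where w: "w \<in> A s" "w \<le> y" "\<forall>z\<in>A s. z \<le> y \<longrightarrow> z \<le> w" "\<alpha> w = \<alpha> (\<tau> s y)"
      using pred[OF s, of y] False y by auto
    have "\<tau> s x \<le> w" using w(3) \<tau>(1)[OF s x] False by auto
    then show ?thesis
      using Ld[of x "\<tau> s x" y w] \<tau>(2)[OF s x] False w x y by auto
  qed
  have lip_s: "dist (\<alpha> (\<tau> s t)) (\<alpha> (\<tau> s' t)) \<le> L * (s' - s)"
    if s: "s \<in> {0..1}" and s': "s' \<in> {0..1}" and t: "t \<in> {0..1}" and "s \<le> s'" for s s' t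
  proof -
    define b where "b = \<tau> s s'"
    note b = \<tau>[OF s s', folded b_def] and u = \<tau>[OF s t] and u' = \<tau>[OF s' t]
    obtain w where w: "w \<in> A s" "w \<le> s'" "\<forall>z\<in>A s. z \<le> s' \<longrightarrow> z \<le> w" "\<alpha> w = \<alpha> b"
      using pred[OF s, of s'] \<open>s \<le> s'\<close> s' by (auto simp: b_def)
    have sw: "s \<le> w" using w(1) by (simp add: A_def)
    obtain b' where b': "0 \<le> b'" "b' \<le> s" "R b' b" using b(1) by (auto simp: A_def)
    have A_sub: "z \<in> A s'" if "z \<in> A s" "s' \<le> z" for z
      using that \<open>s \<le> s'\<close> by (fastforce simp: A_def)
    have near: ?thesis if "s \<le> x" "x \<le> s'" "\<alpha> (\<tau> s t) = \<alpha> x"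
      and "s \<le> x'" "x' \<le> s'" "\<alpha> (\<tau> s' t) = \<alpha> x'" for x x'
      using Ld[of s x s' x'] that s s' by auto
    \<comment> \<open>Beyond \<open>b\<close> the sets \<open>A s\<close> and \<open>A s'\<close> agree, since pairs with one end between \<open>s\<close> and \<open>s'\<close>
        cannot be linked with \<open>b'\<close> and \<open>b\<close>. Before \<open>b\<close> both values are attained by \<open>\<alpha>\<close> between \<open>s\<close> and \<open>s'\<close>.\<close>
    consider "t \<le> w" | "w < t" "t \<le> b" | "b < t" by linarith
    then show ?thesis
    proof cases
      case 1
      have "\<tau> s t \<le> w" by (rule u(3)[OF w(1) 1])
      moreover have "s \<le> \<tau> s t" using u(1) by (simp add: A_def)
      moreover have "\<tau> s' t \<le> s'" using u'(3)[OF A_start[OF s']] 1 w(2) by auto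
      moreover have "s' \<le> \<tau> s' t" using u'(1) by (simp add: A_def)
      ultimately show ?thesis using near[of "\<tau> s t" "\<tau> s' t"] w(2) \<open>s \<le> s'\<close> by auto
    next
      case 2
      have "\<tau> s t \<le> b" by (rule u(3)[OF b(1) 2(2)])
      moreover have "b \<le> \<tau> s t"
        using b(3)[OF u(1)] w(3) u(1,2) 2(1) by fastforce
      ultimately have tb: "\<alpha> (\<tau> s t) = \<alpha> w" using w(4) by simp
      have le: "\<tau> s' t \<le> b" by (rule u'(3)[OF A_sub[OF b(1,2)] 2(2)])
      obtain x where x: "0 \<le> x" "x \<le> s'" "R x (\<tau> s' t)" and s'u: "s' \<le> \<tau> s' t" "\<tau> s' t \<le> 1"
        using u'(1) by (auto simp: A_def)
      show ?thesis
      proof (cases "s \<le> x")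
        case True
        have "\<alpha> x = \<alpha> (\<tau> s' t)" using eq[OF x(1) _ s'u(2) x(3)] x s'u by auto
        then show ?thesis using near[OF sw w(2) tb True x(2)] by simp
      next
        case False
        then have "\<tau> s' t \<in> A s" using x s'u \<open>s \<le> s'\<close> by (auto simp: A_def)
        then have "\<tau> s' t = b" using b(3)[OF _ s'u(1)] le by auto
        then show ?thesis using near[OF sw w(2) tb sw w(2)] w(4) by simp
      qed
    next
      case 3
      have "z \<in> A s" if z: "z \<in> A s'" "b < z" for z
      proof -
        obtain x where x: "0 \<le> x" "x \<le> s'" "R x z" "z \<le> 1" using z by (auto simp: A_def)
        show ?thesis
        proof (cases "x \<le> s")
          case True
          then show ?thesis using x z \<open>s \<le> s'\<close> by (auto simp: A_def)
        next
          case False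
          then have "R b' z" using cross[of b' x b z] b' b(2) x z by auto
          then show ?thesis using b' x z \<open>s \<le> s'\<close> by (auto simp: A_def)
        qed
      qed
      then have "\<tau> s t \<le> \<tau> s' t" using u(3) u'(1,2) 3 by auto
      moreover have "\<tau> s' t \<le> \<tau> s t" using u'(3)[OF A_sub[OF u(1)]] u(2) 3 b(2) by auto
      ultimately show ?thesis using L0 \<open>s \<le> s'\<close> by simp
    qed
  qed
  have \<tau>01: "\<tau> s t \<in> {0..1}" if "s \<in> {0..1}" "t \<in> {0..1}" for s t
    using \<tau>(1)[OF that] that by (auto simp: A_def)
  show ?thesis
  proof (rule lip_homotopicI[where H = "\<lambda>(s, t). \<alpha> (\<tau> s t)" and C = L and D = L])
    fix t :: real assume t: "t \<in> {0..1}"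
    have "dist (\<alpha> (\<tau> x t)) (\<alpha> (\<tau> y t)) \<le> L * dist x y" if "x \<in> {0..1}" "y \<in> {0..1}" for x y
      using lip_s[OF that t] lip_s[OF that(2,1) t]
      by (cases "x \<le> y") (auto simp: dist_real_def dist_commute)
    then show "L-lipschitz_on {0..1} (\<lambda>s. case (s, t) of (s, t) \<Rightarrow> \<alpha> (\<tau> s t))"
      using L0 by (intro lipschitz_onI) auto
    have "\<tau> 0 t \<in> A 0" using \<tau>(1)[of 0 t] t by simp
    then show "(case (0, t) of (s, t) \<Rightarrow> \<alpha> (\<tau> s t)) = \<alpha> 0"
      using eq[of 0 "\<tau> 0 t"] by (auto simp: A_def)
    have "\<tau> 1 t \<in> A 1" using \<tau>(1)[of 1 t] t by simp
    then show "(case (1, t) of (s, t) \<Rightarrow> \<alpha> (\<tau> s t)) = \<alpha> 1"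
      by (auto simp: A_def)
  next
    fix s :: real assume s: "s \<in> {0..1}"
    have "dist (\<alpha> (\<tau> s x)) (\<alpha> (\<tau> s y)) \<le> L * dist x y" if "x \<in> {0..1}" "y \<in> {0..1}" for x y
      using lip_t[OF s that] lip_t[OF s that(2,1)]
      by (cases "x \<le> y") (auto simp: dist_real_def dist_commute)
    then show "L-lipschitz_on {0..1} (\<lambda>t. case (s, t) of (s, t) \<Rightarrow> \<alpha> (\<tau> s t))"
      using L0 by (intro lipschitz_onI) auto
    have "\<tau> s 0 = s"
      using \<tau>(1,3)[of s 0] A_start[OF s] s by (force simp: A_def)
    then show "(case (s, 0) of (s, t) \<Rightarrow> \<alpha> (\<tau> s t)) = \<alpha> s" by simp
    have "\<tau> s 1 = 1"
      using \<tau>(2)[of s 1] \<tau>01[of s 1] s by auto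
    then show "(case (s, 1) of (s, t) \<Rightarrow> \<alpha> (\<tau> s t)) = \<alpha> 1" by simp
  next
    fix s t :: real assume "s \<in> {0..1}" "t \<in> {0..1}"
    then show "(case (s, t) of (s, t) \<Rightarrow> \<alpha> (\<tau> s t)) \<in> M"
      using \<tau>01 \<alpha>M by auto
  qed
qed

section \<open>Points joined by nearly constant paths in the square\<close>

definition bottom :: "real \<Rightarrow> real^2" where
  "bottom s = s *\<^sub>R axis 1 1"

definition near_fibre :: "(real^2 \<Rightarrow> 'b::metric_space) \<Rightarrow> 'b \<Rightarrow> real \<Rightarrow> (real^2) set" where
  "near_fibre G y e = {p \<in> cbox 0 1. dist (G p) y < e}"

text \<open>Ties are defined by paths in neighbourhoods of a fibre, not by connected subsets of the fibre
  itself, because the planar crossing theorem is about paths; that they are only approximately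
  in the fibre makes the relation closed without any compactness argument.\<close>

definition tied :: "(real^2 \<Rightarrow> 'b::metric_space) \<Rightarrow> real \<Rightarrow> real \<Rightarrow> bool" where
  "tied G s t \<longleftrightarrow> (\<forall>e>0. path_component (near_fibre G (G (bottom s)) e) (bottom s) (bottom t))"

lemma bottom_nth [simp]: "bottom s $ 1 = s" "bottom s $ 2 = 0"
  by (simp_all add: bottom_def axis_def)

lemma mem_unit_square: "p \<in> cbox (0::real^2) 1 \<longleftrightarrow> 0 \<le> p $ 1 \<and> p $ 1 \<le> 1 \<and> 0 \<le> p $ 2 \<and> p $ 2 \<le> 1"
  by (auto simp: mem_box_cart forall_2)

lemma continuous_on_bottom: "continuous_on S bottom"
  unfolding bottom_def by (intro continuous_intros)

lemma closed_segment_bottom: "closed_segment (bottom a) (bottom b) = bottom ` closed_segment a b"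
  unfolding bottom_def by (intro closed_segment_linear_image linearI) (auto simp: scaleR_add_left)

lemma tied_imp_eq:
  assumes "tied G s t" shows "G (bottom s) = G (bottom t)"
proof (rule ccontr)
  assume "G (bottom s) \<noteq> G (bottom t)"
  then have "path_component (near_fibre G (G (bottom s)) (dist (G (bottom t)) (G (bottom s)))) (bottom s) (bottom t)"
    using assms by (simp add: tied_def)
  from path_component_mem(2)[OF this] show False by (simp add: near_fibre_def)
qed

lemma path_component_bottom:
  assumes "0 \<le> x" "x \<le> 1" "0 \<le> y" "y \<le> 1"
    and "\<And>z. z \<in> closed_segment x y \<Longrightarrow> dist (G (bottom z)) w < e"
  shows "path_component (near_fibre G w e) (bottom x) (bottom y)"
proof (rule path_component_linepath)
  have "0 \<le> z \<and> z \<le> 1" if "z \<in> closed_segment x y" for z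
    using that assms(1-4) by (auto simp: closed_segment_eq_real_ivl split: if_splits)
  then show "closed_segment (bottom x) (bottom y) \<subseteq> near_fibre G w e"
    using assms(5) by (auto simp: closed_segment_bottom near_fibre_def mem_unit_square)
qed

lemma tied_refl:
  assumes "0 \<le> s" "s \<le> 1" shows "tied G s s"
  using assms by (auto simp: tied_def intro!: path_component_bottom)

lemma tied_trans:
  assumes "tied G a b" "tied G b c" shows "tied G a c"
  using assms tied_imp_eq[OF assms(1)] unfolding tied_def by (metis path_component_trans)

text \<open>Paths whose ends interlace meet, so the values of \<open>G\<close> at the two pairs are equal, and one can change
  from one path to the other where they meet.\<close>

lemma tied_cross:
  assumes ord: "a < b" "b \<le> c" "c < d" and ac: "tied G a c" and bd: "tied G b d"
  shows "tied G a d"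
proof (cases "b = c")
  case True
  then show ?thesis using tied_trans[OF ac] bd by simp
next
  case False
  have meet: "\<exists>z. path_component (near_fibre G (G (bottom a)) e) (bottom a) z
      \<and> path_component (near_fibre G (G (bottom b)) e) (bottom b) z" if "0 < e" for e
  proof -
    obtain f where f: "path f" "path_image f \<subseteq> near_fibre G (G (bottom a)) e"
        "pathstart f = bottom a" "pathfinish f = bottom c"
      using ac \<open>0 < e\<close> unfolding tied_def path_component_def by blast
    obtain g where g: "path g" "path_image g \<subseteq> near_fibre G (G (bottom b)) e"
        "pathstart g = bottom b" "pathfinish g = bottom d"
      using bd \<open>0 < e\<close> unfolding tied_def path_component_def by blast
    have "path_image f \<subseteq> cbox 0 1" "path_image g \<subseteq> cbox 0 1"
      using f(2) g(2) by (auto simp: near_fibre_def)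
    then obtain z where "z \<in> path_image f" "z \<in> path_image g"
      using fashoda_interlace[of f g 0 1] f g ord False by auto
    then have "path_component (path_image f) (bottom a) z" "path_component (path_image g) (bottom b) z"
      using path_component_path_image_pathstart f g by metis+
    then show ?thesis using f(2) g(2) path_component_of_subset by metis
  qed
  have ab: "G (bottom a) = G (bottom b)"
  proof (rule ccontr)
    assume "G (bottom a) \<noteq> G (bottom b)"
    then have "0 < dist (G (bottom a)) (G (bottom b)) / 2" by simp
    from meet[OF this] obtain z
      where "z \<in> near_fibre G (G (bottom a)) (dist (G (bottom a)) (G (bottom b)) / 2)"
        "z \<in> near_fibre G (G (bottom b)) (dist (G (bottom a)) (G (bottom b)) / 2)"
      using path_component_mem(2) by metis
    then show False
      using dist_triangle_half_r[of "G z" "G (bottom a)" "dist (G (bottom a)) (G (bottom b))" "G (bottom b)"]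
      by (simp add: near_fibre_def)
  qed
  show ?thesis
    unfolding tied_def
  proof (intro allI impI)
    fix e :: real assume "0 < e"
    from meet[OF this] obtain z where "path_component (near_fibre G (G (bottom a)) e) (bottom a) z"
      "path_component (near_fibre G (G (bottom a)) e) (bottom b) z"
      using ab by auto
    moreover have "path_component (near_fibre G (G (bottom a)) e) (bottom b) (bottom d)"
      using bd \<open>0 < e\<close> ab by (simp add: tied_def)
    ultimately show "path_component (near_fibre G (G (bottom a)) e) (bottom a) (bottom d)"
      by (metis path_component_sym path_component_trans)
  qed
qed

text \<open>A path between two nearby points is extended to the limit points by short segments of
  the bottom side.\<close>

lemma closed_tied:
  assumes G: "continuous_on UNIV G"
  shows "closed {(s, t). 0 \<le> s \<and> s \<le> t \<and> t \<le> 1 \<and> tied G s t}"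
  unfolding closed_sequential_limits
proof (intro allI impI)
  fix f :: "nat \<Rightarrow> real \<times> real" and l
  assume f: "(\<forall>n. f n \<in> {(s, t). 0 \<le> s \<and> s \<le> t \<and> t \<le> 1 \<and> tied G s t}) \<and> f \<longlonglongrightarrow> l"
  define u v where "u n = fst (f n)" and "v n = snd (f n)" for n
  obtain s t where l: "l = (s, t)" by force
  have uv: "0 \<le> u n" "u n \<le> v n" "v n \<le> 1" "tied G (u n) (v n)" for n
    using f by (auto simp: u_def v_def case_prod_beta)
  have lim: "u \<longlonglongrightarrow> s" "v \<longlonglongrightarrow> t"
    unfolding u_def v_def using f tendsto_fst[of f l] tendsto_snd[of f l] by (auto simp: l)
  have st: "0 \<le> s" "s \<le> t" "t \<le> 1"
    using lim uv by (auto intro: LIMSEQ_le_const LIMSEQ_le_const2 LIMSEQ_le)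
  define h where "h = (\<lambda>x. G (bottom x))"
  have h: "continuous_on UNIV h"
    unfolding h_def by (rule continuous_on_compose2[OF G continuous_on_bottom]) simp
  have hlim: "(\<lambda>n. h (u n)) \<longlonglongrightarrow> h s" "(\<lambda>n. h (v n)) \<longlonglongrightarrow> h t"
    using h lim by (auto intro: continuous_on_tendsto_compose)
  have huv: "h (u n) = h (v n)" for n
    using tied_imp_eq[OF uv(4)] by (simp add: h_def)
  then have hst: "h s = h t" using hlim LIMSEQ_unique by auto
  have "tied G s t"
    unfolding tied_def
  proof (intro allI impI)
    fix e :: real assume "0 < e"
    obtain d where d: "0 < d" "\<And>x. dist x s < d \<Longrightarrow> dist (h x) (h s) < e / 2"
      using h \<open>0 < e\<close> unfolding continuous_on_iff by (metis UNIV_I half_gt_zero)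
    obtain d' where d': "0 < d'" "\<And>x. dist x t < d' \<Longrightarrow> dist (h x) (h t) < e / 2"
      using h \<open>0 < e\<close> unfolding continuous_on_iff by (metis UNIV_I half_gt_zero)
    have "eventually (\<lambda>n. dist (u n) s < d \<and> dist (v n) t < d') sequentially"
      using lim d(1) d'(1) by (auto intro: eventually_conj tendstoD)
    then obtain n where n: "dist (u n) s < d" "dist (v n) t < d'"
      by (auto dest: eventually_happens)
    let ?N = "near_fibre G (h s) e"
    have "path_component ?N (bottom s) (bottom (u n))"
    proof (rule path_component_bottom)
      fix z assume "z \<in> closed_segment s (u n)"
      then have "dist z s < d" using n(1) by (auto simp: dist_real_def closed_segment_eq_real_ivl split: if_splits)
      then show "dist (G (bottom z)) (h s) < e" using d(2)[of z] \<open>0 < e\<close> by (simp add: h_def)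
    qed (use st uv(1-3)[of n] in auto)
    moreover have "path_component ?N (bottom (u n)) (bottom (v n))"
    proof (rule path_component_of_subset)
      show "path_component (near_fibre G (h (u n)) (e / 2)) (bottom (u n)) (bottom (v n))"
        using uv(4)[of n] \<open>0 < e\<close> by (simp add: tied_def h_def)
      show "near_fibre G (h (u n)) (e / 2) \<subseteq> ?N"
        using d(2)[OF n(1)] dist_triangle_half_r[of "h (u n)" _ e "h s"]
        by (auto simp: near_fibre_def dist_commute)
    qed
    moreover have "path_component ?N (bottom (v n)) (bottom t)"
    proof (rule path_component_bottom)
      fix z assume "z \<in> closed_segment (v n) t"
      then have "dist z t < d'" using n(2) by (auto simp: dist_real_def closed_segment_eq_real_ivl split: if_splits)
      then show "dist (G (bottom z)) (h s) < e" using d'(2)[of z] \<open>0 < e\<close> hst by (simp add: h_def)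
    qed (use st uv(1-3)[of n] in auto)
    ultimately show "path_component (near_fibre G (G (bottom s)) e) (bottom s) (bottom t)"
      unfolding h_def by (metis path_component_trans)
  qed
  with st show "l \<in> {(s, t). 0 \<le> s \<and> s \<le> t \<and> t \<le> 1 \<and> tied G s t}"
    by (simp add: l)
qed

text \<open>The map is taken to be defined on the whole plane, constant along the fibres of the
  retraction to the square, because in the plane a closed set that separates two points has a
  connected component that separates them. The points \<open>c\<close> and \<open>d\<close> are joined in two ways:
  by the bottom side, and by the two ties together with the bottom side between \<open>a\<close> and \<open>b\<close>. A
  separating component must meet both, and it can meet them only on the bottom side, because
  along the ties \<open>G\<close> is nearly constant and stays off the chosen sphere.\<close>

lemma tied_gap:
  fixes G :: "real^2 \<Rightarrow> 'b::metric_space"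
  assumes G: "continuous_on UNIV G" and clamp: "\<And>p. G (clamp 0 1 p) = G p"
    and null: "hausdorff2 (range G) = 0"
    and ord: "0 \<le> a" "a < b" "b \<le> c" "c < d" "d \<le> 1"
    and ad: "tied G a d" and bc: "tied G b c" and ne: "G (bottom c) \<noteq> G (bottom d)"
  obtains x y where "a < x" "x < b" "c < y" "y < d" "tied G x y"
proof -
  have Ga: "G (bottom a) = G (bottom d)" and Gb: "G (bottom b) = G (bottom c)"
    using tied_imp_eq[OF ad] tied_imp_eq[OF bc] by auto
  define v where "v = (\<lambda>p. dist (G (bottom c)) (G p))"
  define D where "D = dist (G (bottom c)) (G (bottom d))"
  have D: "0 < D" using ne by (simp add: D_def)
  obtain r where r: "0 < r" "r < D" and triv: "\<And>C p q. connected C \<Longrightarrow>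
      C \<subseteq> range G \<inter> sphere (G (bottom c)) r \<Longrightarrow> p \<in> C \<Longrightarrow> q \<in> C \<Longrightarrow> p = q"
    using obtain_sphere_with_trivial_connected_subsets[OF null D, of "G (bottom c)"] by blast
  have v: "continuous_on UNIV v"
    unfolding v_def by (intro continuous_intros G)
  have v_vals: "v (bottom c) = 0" "v (bottom d) = D" "v (bottom b) = 0" "v (bottom a) = D"
    by (simp_all add: v_def D_def Ga Gb)
  define S where "S = {p. v p = r}"
  have "closed S"
    unfolding S_def by (intro closed_Collect_eq v continuous_on_const)
  moreover have "\<not> connected_component (- S) (bottom c) (bottom d)"
  proof
    assume "connected_component (- S) (bottom c) (bottom d)"
    then obtain T where T: "connected T" "T \<subseteq> - S" "bottom c \<in> T" "bottom d \<in> T"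
      unfolding connected_component_def by blast
    have "connected (v ` T)"
      by (rule connected_continuous_image[OF continuous_on_subset[OF v] T(1)]) simp
    moreover have "0 \<in> v ` T" "D \<in> v ` T" using T(3,4) v_vals by (metis imageI)+
    ultimately have "r \<in> v ` T" using connected_contains_Icc[of "v ` T" 0 D] r by auto
    with T(2) show False by (auto simp: S_def)
  qed
  ultimately obtain C where C: "C \<in> components S" and sep: "\<not> connected_component (- C) (bottom c) (bottom d)"
    by (rule separation_by_component_closed_pointwise)
  have CS: "C \<subseteq> S" and Cc: "connected C"
    using C in_components_subset in_components_connected by auto
  obtain y where y: "c < y" "y < d" "bottom y \<in> C"
  proof -
    have "\<not> bottom ` {c..d} \<subseteq> - C"
    proof
      assume "bottom ` {c..d} \<subseteq> - C"
      moreover have "connected (bottom ` {c..d})"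
        by (intro connected_continuous_image continuous_on_bottom connected_Icc)
      ultimately have "connected_component (- C) (bottom c) (bottom d)"
        using ord unfolding connected_component_def by (intro exI[of _ "bottom ` {c..d}"]) auto
      with sep show False by simp
    qed
    then obtain y where "c \<le> y" "y \<le> d" "bottom y \<in> C" by auto
    moreover from this have "v (bottom y) = r" using CS by (auto simp: S_def)
    then have "y \<noteq> c" "y \<noteq> d" using v_vals r by auto
    ultimately show ?thesis using that[of y] by auto
  qed
  have conn: "connected_component N p q" if "path_component N p q" for N :: "(real^2) set" and p q
    using that path_component_subset_connected_component[of N p] by auto
  obtain x where x: "a < x" "x < b" "bottom x \<in> C"
  proof -
    have "\<not> bottom ` {a..b} \<subseteq> - C"
    proof
      assume "bottom ` {a..b} \<subseteq> - C"
      moreover have "connected (bottom ` {a..b})"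
        by (intro connected_continuous_image continuous_on_bottom connected_Icc)
      ultimately have 1: "connected_component (- C) (bottom b) (bottom a)"
        using ord unfolding connected_component_def by (intro exI[of _ "bottom ` {a..b}"]) auto
      have "connected_component (near_fibre G (G (bottom b)) r) (bottom b) (bottom c)"
        using bc r by (intro conn) (simp add: tied_def)
      moreover have "near_fibre G (G (bottom b)) r \<subseteq> - C"
        using CS by (auto simp: near_fibre_def S_def v_def Gb dist_commute)
      ultimately have 2: "connected_component (- C) (bottom b) (bottom c)"
        by (metis connected_component_of_subset)
      have "connected_component (near_fibre G (G (bottom a)) (D - r)) (bottom a) (bottom d)"
        using ad r by (intro conn) (simp add: tied_def)
      moreover have "near_fibre G (G (bottom a)) (D - r) \<subseteq> - C"
      proof
        fix p assume "p \<in> near_fibre G (G (bottom a)) (D - r)"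
        then have "dist (G p) (G (bottom d)) < D - r" by (simp add: near_fibre_def Ga)
        then have "v p \<noteq> r"
          using dist_triangle[of "G (bottom c)" "G (bottom d)" "G p"] by (auto simp: v_def D_def)
        then show "p \<in> - C" using CS by (auto simp: S_def)
      qed
      ultimately have "connected_component (- C) (bottom a) (bottom d)"
        by (metis connected_component_of_subset)
      with 1 2 sep show False
        by (metis connected_component_sym connected_component_trans)
    qed
    then obtain x where "a \<le> x" "x \<le> b" "bottom x \<in> C" by auto
    moreover from this have "v (bottom x) = r" using CS by (auto simp: S_def)
    then have "x \<noteq> a" "x \<noteq> b" using v_vals r by auto
    ultimately show ?thesis using that[of x] by auto
  qed
  have const: "G p = G (bottom x)" if "p \<in> C" for p
  proof (rule triv)
    show "connected (G ` C)"
      by (rule connected_continuous_image[OF continuous_on_subset[OF G] Cc]) simp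
    show "G ` C \<subseteq> range G \<inter> sphere (G (bottom c)) r"
      using CS by (auto simp: S_def v_def)
  qed (use that x in auto)
  have "tied G x y"
    unfolding tied_def
  proof (intro allI impI)
    fix e :: real assume "0 < e"
    \<comment> \<open>A component need not be path connected, but it has open neighbourhoods of small variation
        of \<open>G\<close>, in which its points are joined by paths; these are then retracted to the square.\<close>
    define U where "U = {p. dist (G p) (G (bottom x)) < e}"
    have "open U"
      unfolding U_def by (intro open_Collect_less continuous_intros G)
    moreover have "C \<subseteq> U" using const \<open>0 < e\<close> by (auto simp: U_def)
    then have "connected_component U (bottom x) (bottom y)"
      using Cc x y unfolding connected_component_def by blast
    ultimately have "path_component U (bottom x) (bottom y)"
      by (simp add: open_path_connected_component)
    then obtain q where q: "path q" "path_image q \<subseteq> U" "pathstart q = bottom x" "pathfinish q = bottom y"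
      unfolding path_component_def by blast
    have "continuous_on (path_image q) (clamp 0 (1::real^2))"
      by (rule clamp_continuous_on[where f = "\<lambda>p. p"]) (rule continuous_on_id)
    with q(1) have "path (clamp 0 1 \<circ> q)" by (rule path_continuous_image)
    moreover have "clamp 0 1 p \<in> cbox (0::real^2) 1" for p
      by (rule clamp_in_interval) (auto simp: Basis_vec_def inner_axis)
    then have "path_image (clamp 0 1 \<circ> q) \<subseteq> near_fibre G (G (bottom x)) e"
      using q(2) by (auto simp: path_image_compose near_fibre_def clamp U_def)
    moreover have "bottom x \<in> cbox 0 1" "bottom y \<in> cbox 0 1"
      using x y ord by (auto simp: mem_unit_square)
    ultimately show "path_component (near_fibre G (G (bottom x)) e) (bottom x) (bottom y)"
      unfolding path_component_def using q(3,4)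
      by (intro exI[of _ "clamp 0 1 \<circ> q"]) (auto simp: pathstart_compose pathfinish_compose)
  qed
  with x y show ?thesis using that by blast
qed

text \<open>The path runs around the other three sides of the square, where a null homotopy of a loop is
  constant.\<close>

lemma tied_ends:
  fixes G :: "real^2 \<Rightarrow> 'b::metric_space"
  assumes const: "\<And>p. p \<in> cbox 0 1 \<Longrightarrow> p $ 1 = 0 \<or> p $ 2 = 1 \<or> p $ 1 = 1 \<Longrightarrow> G p = w"
  shows "tied G 0 1"
  unfolding tied_def
proof (intro allI impI)
  fix e :: real assume "0 < e"
  let ?N = "near_fibre G (G (bottom 0)) e"
  have w: "G (bottom 0) = w" by (rule const) (auto simp: mem_unit_square)
  have edge: "path_component ?N p q" if "cbox l u \<subseteq> {p \<in> cbox 0 1. p $ 1 = 0 \<or> p $ 2 = 1 \<or> p $ 1 = 1}"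
    "p \<in> cbox l u" "q \<in> cbox l u" for p q l u
  proof (rule path_component_of_subset)
    show "cbox l u \<subseteq> ?N"
      using that(1) const \<open>0 < e\<close> by (force simp: near_fibre_def w)
    show "path_component (cbox l u) p q"
      using that(2,3) convex_imp_path_connected[OF convex_box(1)] path_connected_component by blast
  qed
  have "path_component ?N (bottom 0) (axis 2 1)"
    by (rule edge[of 0 "axis 2 1"]) (auto simp: mem_box_cart forall_2 axis_def)
  moreover have "path_component ?N (axis 2 1) 1"
    by (rule edge[of "axis 2 1" 1]) (auto simp: mem_box_cart forall_2 axis_def)
  moreover have "path_component ?N 1 (bottom 1)"
    by (rule edge[of "axis 1 1" 1]) (auto simp: mem_box_cart forall_2 axis_def)
  ultimately show "path_component ?N (bottom 0) (bottom 1)"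
    by (metis path_component_trans)
qed

section \<open>Injectivity of the induced homomorphism\<close>

text \<open>Injectivity turns coincidences of \<open>\<phi> \<circ> \<alpha>\<close>, which the null homotopy in \<open>Y\<close> provides, into coincidences
  of \<open>\<alpha>\<close>, which the contraction in \<open>X\<close> requires.\<close>

lemma lip_nullhomotopic_if_injective_image_nullhomotopic:
  fixes \<phi> :: "'a::metric_space \<Rightarrow> 'b::metric_space"
  assumes Y: "purely_2_unrectifiable Y" and inj: "inj_on \<phi> X" and \<alpha>: "lip_path X \<alpha>"
    and hom: "lip_homotopic Y (\<phi> \<circ> \<alpha>) (\<lambda>_. y)"
  shows "lip_homotopic X \<alpha> (\<lambda>_. \<alpha> 1)"
proof -
  obtain H C where HY: "H \<in> {0..1} \<times> {0..1} \<rightarrow> Y" and C: "lip_square C H"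
    and H: "\<forall>s\<in>{0..1}. H (s, 0) = \<phi> (\<alpha> s)" "\<forall>s\<in>{0..1}. H (s, 1) = y"
      "\<forall>t\<in>{0..1}. H (0, t) = y" "\<forall>t\<in>{0..1}. H (1, t) = y"
    using hom unfolding lip_homotopic_def pathstart_def pathfinish_def by auto
  define G where "G p = H (clamp 0 1 p $ 1, clamp 0 1 p $ 2)" for p :: "real^2"
  have cl: "clamp 0 1 p \<in> cbox (0::real^2) 1" for p
    by (rule clamp_in_interval) (auto simp: Basis_vec_def inner_axis)
  then have cl01: "clamp 0 1 p $ 1 \<in> {0..1}" "clamp 0 1 p $ 2 \<in> {0..1}" for p :: "real^2"
    by (auto simp: mem_unit_square)
  have G_square: "G p = H (p $ 1, p $ 2)" if "p \<in> cbox 0 1" for p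
    using that by (simp add: G_def)
  have clamp: "G (clamp 0 1 p) = G p" for p
    using cl by (simp add: G_def)
  have lip: "(2 * C)-lipschitz_on UNIV G"
  proof (rule lipschitz_onI)
    have C0: "0 \<le> C" using C by (simp add: lip_square_def)
    then show "0 \<le> 2 * C" by simp
    fix p q :: "real^2"
    let ?p = "clamp 0 1 p" and ?q = "clamp 0 1 q"
    have "dist (G p) (G q) \<le> C * (\<bar>?p $ 1 - ?q $ 1\<bar> + \<bar>?p $ 2 - ?q $ 2\<bar>)"
      unfolding G_def by (rule lip_squareD[OF C cl01 cl01])
    also have "\<dots> \<le> C * (dist ?p ?q + dist ?p ?q)"
      using C0 dist_vec_nth_le[of ?p 1 ?q] dist_vec_nth_le[of ?p 2 ?q]
      by (intro mult_left_mono add_mono) (auto simp: dist_real_def)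
    also have "\<dots> \<le> C * (dist p q + dist p q)"
      using C0 by (intro mult_left_mono add_mono dist_clamps_le_dist_args)
    finally show "dist (G p) (G q) \<le> 2 * C * dist p q" by simp
  qed
  have contG: "continuous_on UNIV G"
    using lip by (rule lipschitz_on_continuous_on)
  have "G \<in> cbox 0 1 \<rightarrow> Y"
    using HY by (auto simp: G_square mem_unit_square Pi_iff)
  then have "hausdorff2 (G ` cbox 0 1) = 0"
    using Y lipschitz_on_subset[OF lip] unfolding purely_2_unrectifiable_def
    by (metis borel_closed closed_cbox subset_UNIV)
  moreover have "range G = G ` cbox 0 1"
    using clamp cl by (metis (no_types, lifting) image_subset_iff image_mono imageI rangeE subsetI subset_antisym subset_UNIV)
  ultimately have null: "hausdorff2 (range G) = 0" by simp
  have G_bottom: "G (bottom s) = \<phi> (\<alpha> s)" if "0 \<le> s" "s \<le> 1" for s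
    using that H(1) by (simp add: G_square mem_unit_square)
  have tied_eq: "G (bottom s) = G (bottom t) \<longleftrightarrow> \<alpha> s = \<alpha> t" if "0 \<le> s" "s \<le> 1" "0 \<le> t" "t \<le> 1" for s t
  proof -
    have "\<alpha> s \<in> X" "\<alpha> t \<in> X" using \<alpha> that by (auto simp: lip_path_def Pi_iff)
    then show ?thesis using that inj_on_eq_iff[OF inj] by (simp add: G_bottom)
  qed
  show ?thesis
  proof (rule lip_nullhomotopic_of_lamination[where R = "tied G"])
    show "tied G 0 1"
      using H by (intro tied_ends[where w = y]) (auto simp: G_square mem_unit_square)
    show "\<alpha> s = \<alpha> t" if "0 \<le> s" "s \<le> t" "t \<le> 1" "tied G s t" for s t
      using tied_eq[of s t] tied_imp_eq[OF that(4)] that by simp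
    show "\<exists>x z. a < x \<and> x < b \<and> c < z \<and> z < d \<and> tied G x z"
      if o: "0 \<le> a" "a < b" "b \<le> c" "c < d" "d \<le> 1" and t: "tied G a d" "tied G b c"
        and ne: "\<alpha> c \<noteq> \<alpha> d" for a b c d
    proof -
      have "G (bottom c) \<noteq> G (bottom d)" using tied_eq[of c d] o ne by simp
      from tied_gap[OF contG clamp null o t this] show ?thesis by blast
    qed
    show "tied G a d" if "a < b" "b \<le> c" "c < d" "tied G a c" "tied G b d" for a b c d
      using that by (rule tied_cross)
  qed (auto intro: \<alpha> tied_refl closed_tied contG)
qed

theorem lemma1p4:
  fixes X :: "'a::metric_space set" and x0 :: 'a
    and Y :: "'b::metric_space set" and y0 :: 'b
    and \<phi> :: "'a \<Rightarrow> 'b"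
  assumes "x0 \<in> X" and "y0 \<in> Y"
    and "purely_2_unrectifiable Y"
    and "bilipschitz_embedding X Y \<phi>" and "\<phi> x0 = y0"
  shows "lip_induced Y \<phi> \<in> mon (lip_pi1 X x0) (lip_pi1 Y y0)"
proof -
  obtain L where \<phi>: "\<phi> \<in> X \<rightarrow> Y" "inj_on \<phi> X" "L-lipschitz_on X \<phi>"
    using assms(4) unfolding bilipschitz_embedding_def by blast
  have "lip_induced Y \<phi> \<in> hom (lip_pi1 X x0) (lip_pi1 Y y0)"
    by (rule lip_induced_hom[OF \<phi>(1,3) assms(5)])
  moreover have "c = \<one>\<^bsub>lip_pi1 X x0\<^esub>"
    if c: "c \<in> carrier (lip_pi1 X x0)" and one: "lip_induced Y \<phi> c = \<one>\<^bsub>lip_pi1 Y y0\<^esub>" for c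
  proof -
    obtain \<alpha> where \<alpha>: "\<alpha> \<in> lip_loops X x0" "c = lip_class X \<alpha>"
      using c by (auto simp: lip_pi1_def)
    then have path: "lip_path X \<alpha>" and end1: "\<alpha> 1 = x0"
      by (auto simp: lip_loops_def pathfinish_def)
    have "lip_path Y (\<lambda>_. y0)"
      using assms(2) by (auto simp: lip_path_def intro!: exI[of _ 0] lipschitz_on_constant)
    moreover have "lip_class Y (\<phi> \<circ> \<alpha>) = lip_class Y (\<lambda>_. y0)"
      using one lip_induced_class[OF path \<phi>(1,3)] \<alpha>(2) by (simp add: lip_pi1_def)
    ultimately have "lip_homotopic Y (\<phi> \<circ> \<alpha>) (\<lambda>_. y0)"
      by (simp add: lip_class_eq_iff)
    then have "lip_homotopic X \<alpha> (\<lambda>_. \<alpha> 1)"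
      by (rule lip_nullhomotopic_if_injective_image_nullhomotopic[OF assms(3) \<phi>(2) path])
    then show ?thesis
      using \<alpha>(2) end1 by (simp add: lip_pi1_def lip_class_eq)
  qed
  ultimately show ?thesis
    using mon_iff_hom_one[OF group_lip_pi1[OF assms(1)] group_lip_pi1[OF assms(2)]] by blast
qed

end
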